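(* Let $H\colon\mathbb{R}^n\to\mathbb{R}^n$ be continuous, let $x^0\in\mathbb{R}^n$ be a starting point of the generalized Newton algorithm, and let $$\Omega:=\{x\in\mathbb{R}^n:\ \|x-x^0\|\le r\}$$ with some $r>0$. Impose the following assumptions: (a) $H$ is metrically regular on $\Omega$ with modulus $\mu>0$, i.e., it is metrically regular around every point $x\in\Omega$ with the same modulus $\mu$. (b) The set-valued map $DH(x)(z)$ converges to $\{0\}$ as $z\to0$ uniformly on $\Omega$, in the sense that for all $\varepsilon>0$ there is $\delta>0$ such that $\|w\|\le\varepsilon$ whenever $w\in DH(x)(z)$, $\|z\|\le\delta$, and $x\in\Omega$. (c) There is $\alpha\in(0,1/\mu)$ such that $$\mu\|H(x^0)\|\le r(1-\alpha\mu)$$ and for all $x,y\in\Omega$ we have $$\|H(x)-H(y)-v\|\le\alpha\|x-y\|\quad\text{whenever } v\in DH(x)(y-x).$$ Then the generalized Newton algorithm is well defined, and the sequence of iterates $\{x^k\}$ remains in $\Omega$ and converges to a solution $\bar x\in\Omega$ of the equation $H(x)=0$. Moreover, we have the error estimate $$\|x^k-\bar x\|\le\frac{\alpha\mu}{1-\alpha\mu}\|x^k-x^{k-1}\|\quad\text{for all } k=1,2,\ldots.$$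
   Context: Generalized Newton algorithm: given $x^0\in\mathbb{R}^n$, for $k=0,1,2,\ldots$ compute $d^k\in\mathbb{R}^n$ with $-H(x^k)\in DH(x^k)(d^k)$ (any solution) and set $x^{k+1}:=x^k+d^k$ (the termination test is disregarded). "Well defined" means that the inclusion for $d^k$ is solvable at each iterate. Metric regularity: $H$ is metrically regular around $\bar x$ with modulus $\mu$ if there are neighborhoods $U$ of $\bar x$ and $V$ of $H(\bar x)$ such that $\mathrm{dist}(x;H^{-1}(y))\le\mu\|y-H(x)\|$ for all $x\in U$, $y\in V$ (with $\mathrm{dist}(x;\emptyset)=\infty$). Graphical derivative: $DH(x)(z)$ is the set of $w$ such that there are $t_k\downarrow0$, $h_k\to z$ with $(H(x+t_kh_k)-H(x))/t_k\to w$; equivalently $(z,w)$ lies in the Bouligand tangent cone to the graph of $H$ at $(x,H(x))$. *)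

theory Defs
  imports "HOL-Analysis.Analysis"
begin

definition graphical_derivative ::
  "('a::real_normed_vector \<Rightarrow> 'b::real_normed_vector) \<Rightarrow> 'a \<Rightarrow> 'a \<Rightarrow> 'b set" where
  "graphical_derivative H x z =
     {w. \<exists>t h. (\<forall>k. 0 < t k) \<and> t \<longlonglongrightarrow> 0 \<and> h \<longlonglongrightarrow> z \<and>
           (\<lambda>k. (H (x + t k *\<^sub>R h k) - H x) /\<^sub>R t k) \<longlonglongrightarrow> w}"

text \<open>The library's infdist x {} is 0, whereas metric regularity needs the distance to the
  empty set to be infinite (so that nearby equations are solvable); hence the value in ereal,
  where the infimum over the empty set is \<infinity>.\<close>

definition ext_dist :: "'a::metric_space \<Rightarrow> 'a set \<Rightarrow> ereal" where
  "ext_dist x A = (INF u\<in>A. ereal (dist x u))"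

definition metrically_regular_around ::
  "('a::real_normed_vector \<Rightarrow> 'b::real_normed_vector) \<Rightarrow> real \<Rightarrow> 'a \<Rightarrow> bool" where
  "metrically_regular_around H \<mu> xbar \<longleftrightarrow>
     (\<exists>U V. open U \<and> xbar \<in> U \<and> open V \<and> H xbar \<in> V \<and>
        (\<forall>x\<in>U. \<forall>y\<in>V. ext_dist x (H -` {y}) \<le> ereal (\<mu> * norm (y - H x))))"

text \<open>All points that some run of the algorithm can reach after finitely many steps, whatever
  solutions of the Newton inclusion were selected on the way.\<close>

inductive newton_iterate ::
  "('a::real_normed_vector \<Rightarrow> 'a) \<Rightarrow> 'a \<Rightarrow> 'a \<Rightarrow> bool" for H x0 where
  start: "newton_iterate H x0 x0"
| step: "newton_iterate H x0 x \<Longrightarrow> - H x \<in> graphical_derivative H x d \<Longrightarrow>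
         newton_iterate H x0 (x + d)"

definition newton_well_defined ::
  "('a::real_normed_vector \<Rightarrow> 'a) \<Rightarrow> 'a \<Rightarrow> bool" where
  "newton_well_defined H x0 \<longleftrightarrow>
     (\<forall>x. newton_iterate H x0 x \<longrightarrow> (\<exists>d. - H x \<in> graphical_derivative H x d))"

definition newton_sequence ::
  "('a::real_normed_vector \<Rightarrow> 'a) \<Rightarrow> 'a \<Rightarrow> (nat \<Rightarrow> 'a) \<Rightarrow> bool" where
  "newton_sequence H x0 x \<longleftrightarrow>
     x 0 = x0 \<and>
     (\<exists>d. \<forall>k. - H (x k) \<in> graphical_derivative H (x k) (d k) \<and> x (Suc k) = x k + d k)"

text \<open>On the estimate assumed in the Kantorovich-type theorem. In print it reads
  \<open>norm (H x - H y - v) \<le> \<alpha> * norm (x - y)\<close> for v in the graphical derivative of H at x in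
  direction \<open>y - x\<close>. Such a v approximates \<open>H y - H x\<close>, so the printed form has a sign slip:
  together with the other hypotheses it forces \<open>2 * norm w \<le> \<alpha> * \<mu> * norm w < norm w\<close> for some
  nonzero w and is never satisfied. The intended bound is on \<open>H y - H x - v\<close>. The theorem assumes
  that one of the two forms holds throughout, so it contains the printed statement verbatim as
  well as the intended, nonvacuous one.\<close>

end

theory Submission
  imports Defs
begin

text \<open>By metric regularity, the Newton inclusion at \<open>x\<close> has a solution of norm at most \<open>\<mu> * norm (H x)\<close>. The
  algorithm may however select any other solution, and the essential point is that every solution obeys
  the same bound (\<open>graphical_derivative_inverse_bound\<close>). Once this is known, the linearization
  estimate bounds each new residual by \<open>\<alpha>\<close> times the length of the last step, the iteration contracts
  with factor \<open>\<alpha> * \<mu> < 1\<close>, and the starting condition keeps all iterates strictly inside the ball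
  (\<open>newton_convergence\<close>).

  A Newton direction comes from points \<open>v\<close> near \<open>x\<close>, whereas regularity bounds the distance from \<open>x\<close> to some
  solution of \<open>H u = H v\<close>, possibly a different one: the map \<open>z\<^sup>2 / norm z\<close> of the complex plane is metrically
  regular around 0 but takes the same value at \<open>z\<close> and \<open>-z\<close>. To identify \<open>u\<close> with \<open>v\<close> it is shown that
  \<open>H\<close> is injective near each interior point of \<open>\<Omega>\<close> (\<open>locally_expanding\<close>). If \<open>H\<close> has at \<open>x\<close> a
  derivative \<open>D\<close>, the linearization estimate says that \<open>H (x + Z) - H x\<close> is within \<open>\<alpha> * norm Z\<close> of \<open>D Z\<close>, while by
  regularity all small vectors \<open>w\<close> are such increments with \<open>norm Z \<le> \<mu> * norm w\<close>; as \<open>\<alpha> * \<mu> < 1\<close>, the map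
  \<open>D\<close> is onto and thus invertible. The same argument applies to convex combinations of the derivatives at
  nearby points, and the mean value theorem then gives injectivity.

  Differentiability is supplied by mollification instead of a theorem on differentiability almost
  everywhere. The uniform bound on the graphical derivative makes \<open>H\<close> Lipschitz on \<open>\<Omega>\<close>
  (\<open>calm_if_graphical_derivative_bounded\<close>, \<open>lipschitz_on_if_calm\<close>), and for Lipschitz maps the linearization
  estimate turns into a comparison of short with long chords (\<open>short_chord_near_long_chord\<close>) that is
  stable under averaging over translates. Hence the averages satisfy the linearization estimate with their own derivatives (\<open>bump_average_derivative_near_chord\<close>).

  The alternative form of the estimate, with \<open>H x - H y\<close>, contradicts regularity
  (\<open>reversed_estimate_impossible\<close>).\<close>

section \<open>Averaging against a smooth bump\<close>

text \<open>The smoothing kernel; the square makes it continuously differentiable across the sphere where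
  the maximum switches to 0.\<close>

definition bump :: "real \<Rightarrow> 'a::euclidean_space \<Rightarrow> real" where
  "bump \<delta> q = (max 0 (\<delta>\<^sup>2 - q \<bullet> q))\<^sup>2"

text \<open>The average is an operator on functions, so that the mollification of \<open>f\<close> is
  \<open>\<lambda>x. bump_average \<delta> (\<lambda>q. f (x + q))\<close> and an inequality between increments of \<open>f\<close> that holds for all
  small translates passes to its mollification by linearity. The cube contains the support of the
  bump.\<close>

definition bump_average :: "real \<Rightarrow> ('a::euclidean_space \<Rightarrow> 'b::euclidean_space) \<Rightarrow> 'b" where
  "bump_average \<delta> g =
     integral (cbox (- (\<delta> *\<^sub>R One)) (\<delta> *\<^sub>R One)) (\<lambda>q. bump \<delta> q *\<^sub>R g q) /\<^sub>R
     integral (cbox (- (\<delta> *\<^sub>R One)) (\<delta> *\<^sub>R (One :: 'a))) (bump \<delta>)"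

lemma bump_nonneg: "bump \<delta> q \<ge> 0"
  by (simp add: bump_def)

lemma bump_eq_0:
  assumes "\<delta> > 0" "norm q \<ge> \<delta>" shows "bump \<delta> q = 0"
proof -
  have "\<delta>\<^sup>2 \<le> (norm q)\<^sup>2" using assms by (intro power_mono) auto
  then show ?thesis by (simp add: bump_def power2_norm_eq_inner)
qed

lemma continuous_on_bump [continuous_intros]:
  "continuous_on S f \<Longrightarrow> continuous_on S (\<lambda>x. bump \<delta> (f x))"
  unfolding bump_def by (intro continuous_intros)

lemma ball_subset_cbox_One:
  fixes q :: "'a::euclidean_space"
  assumes "norm q < \<delta>" shows "q \<in> cbox (- (\<delta> *\<^sub>R One)) (\<delta> *\<^sub>R One)"
proof -
  have "\<bar>q \<bullet> i\<bar> \<le> \<delta>" if "i \<in> Basis" for i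
    using Basis_le_norm[OF that, of q] assms by linarith
  then show ?thesis by (auto simp: mem_box abs_le_iff minus_le_iff)
qed

lemma integral_bump_pos:
  fixes \<delta> :: real
  assumes "\<delta> > 0"
  shows "integral (cbox (- (\<delta> *\<^sub>R One)) (\<delta> *\<^sub>R (One :: 'a::euclidean_space))) (bump \<delta>) > 0"
    (is "integral ?B _ > 0")
proof -
  have int: "bump \<delta> integrable_on ?B"
    by (intro integrable_continuous continuous_intros)
  have nonneg: "integral ?B (bump \<delta>) \<ge> 0"
    using int bump_nonneg by (intro integral_nonneg) auto
  have "integral ?B (bump \<delta>) \<noteq> 0"
  proof
    assume "integral ?B (bump \<delta>) = 0"
    then have "(bump \<delta> has_integral 0) ?B" using int by (metis has_integral_integral)
    moreover have "(0::'a) \<in> box (- (\<delta> *\<^sub>R One)) (\<delta> *\<^sub>R One)"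
      using assms by (simp add: mem_box)
    then have "(0::'a) \<in> cbox (- (\<delta> *\<^sub>R One)) (\<delta> *\<^sub>R One)"
      "box (- (\<delta> *\<^sub>R One)) (\<delta> *\<^sub>R One) \<noteq> ({} :: 'a set)"
      using box_subset_cbox by blast+
    ultimately have "bump \<delta> (0::'a) = 0"
      by (intro has_integral_0_cbox_imp_0[where f = "bump \<delta>"])
         (auto intro!: continuous_intros bump_nonneg)
    then show False using assms by (simp add: bump_def)
  qed
  with nonneg show ?thesis by linarith
qed

lemma bump_integrable:
  fixes g :: "'a::euclidean_space \<Rightarrow> 'b::euclidean_space"
  assumes "continuous_on UNIV g"
  shows "(\<lambda>q. bump \<delta> q *\<^sub>R g q) integrable_on cbox a b"
  by (intro integrable_continuous continuous_intros continuous_on_subset[OF assms]) auto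

lemma bump_average_diff:
  assumes "continuous_on UNIV g" "continuous_on UNIV h"
  shows "bump_average \<delta> (\<lambda>q. g q - h q) = bump_average \<delta> g - bump_average \<delta> h"
  by (simp add: bump_average_def scaleR_diff_right integral_diff bump_integrable assms)

lemma bump_average_scaleR:
  "bump_average \<delta> (\<lambda>q. c *\<^sub>R g q) = c *\<^sub>R bump_average \<delta> g"
proof -
  have "(\<lambda>q. bump \<delta> q *\<^sub>R (c *\<^sub>R g q)) = (\<lambda>q. c *\<^sub>R (bump \<delta> q *\<^sub>R g q))"
    by (simp add: fun_eq_iff mult.commute)
  then show ?thesis
    by (simp only: bump_average_def integral_cmul scaleR_left_commute)
qed

lemma bump_average_const:
  assumes "\<delta> > 0" shows "bump_average \<delta> (\<lambda>q::'a::euclidean_space. c) = c"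
proof -
  have "integral (cbox (- (\<delta> *\<^sub>R One)) (\<delta> *\<^sub>R One)) (\<lambda>q::'a. bump \<delta> q *\<^sub>R c) =
    integral (cbox (- (\<delta> *\<^sub>R One)) (\<delta> *\<^sub>R (One::'a))) (bump \<delta>) *\<^sub>R c"
    by (rule integral_unique, rule has_integral_scaleR_left, rule integrable_integral)
       (intro integrable_continuous continuous_intros)
  then show ?thesis
    using integral_bump_pos[OF assms, where 'a='a] by (simp add: bump_average_def)
qed

lemma norm_bump_average_le:
  fixes g :: "'a::euclidean_space \<Rightarrow> 'b::euclidean_space"
  assumes "\<delta> > 0" "continuous_on UNIV g" "\<And>q. norm q < \<delta> \<Longrightarrow> norm (g q) \<le> B"
  shows "norm (bump_average \<delta> g) \<le> B"
proof -
  let ?C = "cbox (- (\<delta> *\<^sub>R One)) (\<delta> *\<^sub>R (One :: 'a))"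
  let ?m = "integral ?C (bump \<delta>)"
  have m: "?m > 0" using integral_bump_pos[OF assms(1)] .
  have "norm (integral ?C (\<lambda>q. bump \<delta> q *\<^sub>R g q)) \<le> integral ?C (\<lambda>q. bump \<delta> q * B)"
  proof (rule integral_norm_bound_integral)
    show "(\<lambda>q. bump \<delta> q *\<^sub>R g q) integrable_on ?C" by (rule bump_integrable[OF assms(2)])
    show "(\<lambda>q. bump \<delta> q * B) integrable_on ?C"
      by (intro integrable_continuous continuous_intros)
    fix q :: 'a
    show "norm (bump \<delta> q *\<^sub>R g q) \<le> bump \<delta> q * B"
    proof (cases "norm q < \<delta>")
      case True
      with assms(3)[of q] show ?thesis by (simp add: bump_nonneg mult_left_mono)
    next
      case False
      then have "bump \<delta> q = 0" by (intro bump_eq_0) (use assms in auto)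
      then show ?thesis by simp
    qed
  qed
  also have "\<dots> = ?m * B" by simp
  finally show ?thesis using m by (simp add: bump_average_def divide_simps mult.commute)
qed

lemma has_derivative_max_0_power2:
  "((\<lambda>t::real. (max 0 t)\<^sup>2) has_derivative (\<lambda>h. 2 * max 0 t * h)) (at t)"
proof -
  have "((\<lambda>t. if t \<in> {0..} then t\<^sup>2 else 0) has_derivative
      (if t \<in> {0..} then (\<lambda>h. 2 * t * h) else (\<lambda>h. 0))) (at t within ({0..} \<union> {..0}))"
    by (rule has_derivative_If_within_closures)
       (auto intro!: derivative_eq_intros simp: closure_closed)
  moreover have "({0..} \<union> {..0}) = (UNIV::real set)" by auto
  moreover have "(\<lambda>t::real. if t \<in> {0..} then t\<^sup>2 else 0) = (\<lambda>t. (max 0 t)\<^sup>2)"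
    by (auto simp: fun_eq_iff max_def)
  moreover have "(if t \<in> {0..} then (\<lambda>h. 2 * t * h) else (\<lambda>h. 0)) = (\<lambda>h. 2 * max 0 t * h)"
    by (auto simp: fun_eq_iff max_def)
  ultimately show ?thesis by (simp only:)
qed

text \<open>A translation moves the point of evaluation from \<open>f\<close> into the kernel, which is smooth; then one may
  differentiate under the integral sign.\<close>

lemma bump_average_differentiable:
  fixes f :: "'a::euclidean_space \<Rightarrow> 'b::euclidean_space"
  assumes "\<delta> > 0" and f: "continuous_on UNIV f"
  shows "(\<lambda>x. bump_average \<delta> (\<lambda>q. f (x + q))) differentiable (at x0)"
proof -
  let ?C = "cbox (- (\<delta> *\<^sub>R One)) (\<delta> *\<^sub>R (One :: 'a))"
  let ?U = "ball x0 1"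
  have "bounded (\<Union>x\<in>?U. (+) x ` ?C)"
  proof -
    have "bounded ((\<lambda>(x, q). x + q) ` (?U \<times> ?C))"
      by (intro bounded_plus bounded_ball bounded_cbox)
    moreover have "(\<Union>x\<in>?U. (+) x ` ?C) \<subseteq> (\<lambda>(x, q). x + q) ` (?U \<times> ?C)" by auto
    ultimately show ?thesis by (rule bounded_subset)
  qed
  then obtain a b where ab: "(\<Union>x\<in>?U. (+) x ` ?C) \<subseteq> cbox a b"
    using bounded_subset_cbox_symmetric by metis
  \<comment> \<open>The translated kernels of all points near \<open>x0\<close> live in one common box.\<close>
  have shift: "integral ?C (\<lambda>q. bump \<delta> q *\<^sub>R f (x + q)) =
    integral (cbox a b) (\<lambda>q. bump \<delta> (q - x) *\<^sub>R f q)" if "x \<in> ?U" for x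
  proof -
    let ?g = "\<lambda>q. bump \<delta> (q - x) *\<^sub>R f q"
    have "integral (cbox (- (\<delta> *\<^sub>R One) + x) (\<delta> *\<^sub>R One + x)) ?g = integral ?C (?g \<circ> (+) x)"
      by (rule integral_shift_cbox_plus[symmetric])
    then have 1: "integral ?C (\<lambda>q. bump \<delta> q *\<^sub>R f (x + q)) =
      integral (cbox (- (\<delta> *\<^sub>R One) + x) (\<delta> *\<^sub>R One + x)) ?g"
      by (simp add: o_def)
    have img: "cbox (- (\<delta> *\<^sub>R One) + x) (\<delta> *\<^sub>R One + x) = (+) x ` ?C"
      unfolding add.commute[of "- (\<delta> *\<^sub>R One)" x] add.commute[of "\<delta> *\<^sub>R One" x]
      by (rule cbox_translation)
    have z: "?g q = 0" if "q \<notin> (+) x ` ?C" for q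
    proof -
      have "q - x \<notin> ?C" using that by (metis add.commute diff_add_cancel image_eqI)
      then have "norm (q - x) \<ge> \<delta>" using ball_subset_cbox_One[of "q - x" \<delta>] by force
      then show ?thesis using bump_eq_0 assms(1) by auto
    qed
    have "?g integrable_on (+) x ` ?C"
      unfolding img[symmetric]
      by (intro integrable_continuous continuous_intros continuous_on_subset[OF f]) auto
    then have "(?g has_integral integral ((+) x ` ?C) ?g) (cbox a b)"
      by (rule has_integral_on_superset[OF integrable_integral z UN_upper[OF that, THEN order_trans, OF ab]])
    then show ?thesis using 1 img by (simp add: integral_unique)
  qed
  define fx where "fx = (\<lambda>x q. (4 * max 0 (\<delta>\<^sup>2 - (q - x) \<bullet> (q - x))) *\<^sub>R
     (blinfun_scaleR_left (f q) o\<^sub>L blinfun_inner_left (q - x)))"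
  have "((\<lambda>x. integral (cbox a b) (\<lambda>q. bump \<delta> (q - x) *\<^sub>R f q)) has_derivative
     integral (cbox a b) (fx x0)) (at x0 within ?U)"
  proof (rule leibniz_rule)
    show "((\<lambda>x. bump \<delta> (q - x) *\<^sub>R f q) has_derivative blinfun_apply (fx x q)) (at x within ?U)"
      for x q
    proof -
      have "((\<lambda>x. \<delta>\<^sup>2 - (q - x) \<bullet> (q - x)) has_derivative (\<lambda>z. 2 * ((q - x) \<bullet> z))) (at x within ?U)"
        by (auto intro!: derivative_eq_intros simp: fun_eq_iff inner_commute algebra_simps)
      from has_derivative_compose[OF this has_derivative_max_0_power2]
      have "((\<lambda>x. bump \<delta> (q - x)) has_derivative
         (\<lambda>z. 2 * max 0 (\<delta>\<^sup>2 - (q - x) \<bullet> (q - x)) * (2 * ((q - x) \<bullet> z)))) (at x within ?U)"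
        by (simp add: bump_def)
      from has_derivative_scaleR_left[OF this, of "f q"] show ?thesis
        by (elim has_derivative_eq_rhs) (simp add: fx_def fun_eq_iff inner_commute blinfun.scaleR_left)
    qed
    show "continuous_on (?U \<times> cbox a b) (\<lambda>(x, q). fx x q)"
      unfolding fx_def split_beta
      by (intro continuous_intros bounded_linear.continuous_on[OF bounded_linear_blinfun_scaleR_left]
         continuous_on_compose2[OF f] bounded_linear.continuous_on[OF bounded_linear_blinfun_inner_left]) auto
    show "(\<lambda>q. bump \<delta> (q - x) *\<^sub>R f q) integrable_on cbox a b" for x
      by (intro integrable_continuous continuous_intros continuous_on_subset[OF f]) auto
  qed auto
  then have "((\<lambda>x. integral ?C (\<lambda>q. bump \<delta> q *\<^sub>R f (x + q))) has_derivative
     integral (cbox a b) (fx x0)) (at x0 within ?U)"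
    by (rule has_derivative_transform[rotated 2]) (auto simp: shift)
  then have "((\<lambda>x. integral ?C (\<lambda>q. bump \<delta> q *\<^sub>R f (x + q))) has_derivative
     integral (cbox a b) (fx x0)) (at x0)"
    by (simp add: at_within_open[of x0 ?U])
  then show ?thesis
    unfolding bump_average_def by (intro differentiable_scaleR) (auto simp: differentiable_def)
qed

section \<open>Graphical derivatives and Lipschitz continuity\<close>

text \<open>The set of points up to which the bound holds is closed, and the local bound to the right of its
  supremum would push the supremum further.\<close>

lemma right_mean_value_inequality:
  fixes f :: "real \<Rightarrow> 'a::real_normed_vector"
  assumes "a \<le> b" and f: "continuous_on {a..b} f"
    and step: "\<And>t. t \<in> {a..<b} \<Longrightarrow>
      \<forall>\<^sub>F s in at_right t. norm (f s - f t - (s - t) *\<^sub>R c) \<le> K * (s - t)"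
  shows "norm (f b - f a - (b - a) *\<^sub>R c) \<le> K * (b - a)"
proof -
  define S where "S = {t \<in> {a..b}. norm (f t - f a - (t - a) *\<^sub>R c) \<le> K * (t - a)}"
  have "closed S" unfolding S_def
    by (intro continuous_on_closed_Collect_le continuous_intros f)
  have "a \<in> S" using assms(1) by (simp add: S_def)
  have bdd: "bdd_above S" by (auto simp: S_def intro: bdd_aboveI)
  define m where "m = Sup S"
  have "m \<in> S" using closed_contains_Sup[OF _ bdd \<open>closed S\<close>] \<open>a \<in> S\<close> by (auto simp: m_def)
  have "m = b"
  proof (rule ccontr)
    assume "m \<noteq> b"
    then have m: "m \<in> {a..<b}" using \<open>m \<in> S\<close> by (auto simp: S_def)
    have "\<forall>\<^sub>F s in at_right m. s \<in> {m<..<b}"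
      using m by (intro eventually_at_right_real) auto
    with step[OF m] have "\<forall>\<^sub>F s in at_right m. s \<in> {m<..<b} \<and>
        norm (f s - f m - (s - m) *\<^sub>R c) \<le> K * (s - m)"
      by eventually_elim auto
    then obtain s where s: "s \<in> {m<..<b}" "norm (f s - f m - (s - m) *\<^sub>R c) \<le> K * (s - m)"
      using eventually_happens'[OF trivial_limit_at_right_real] by blast
    have "norm (f s - f a - (s - a) *\<^sub>R c) =
      norm ((f s - f m - (s - m) *\<^sub>R c) + (f m - f a - (m - a) *\<^sub>R c))"
      by (simp add: algebra_simps)
    also have "\<dots> \<le> K * (s - m) + K * (m - a)"
      using s \<open>m \<in> S\<close> by (intro norm_triangle_le) (auto simp: S_def)
    finally have "s \<in> S" using s m by (auto simp: S_def algebra_simps)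
    then have "s \<le> m" using cSup_upper[OF _ bdd] by (simp add: m_def)
    then show False using s by simp
  qed
  then show ?thesis using \<open>m \<in> S\<close> by (simp add: S_def)
qed

lemma graphical_derivative_scaleR:
  assumes "w \<in> graphical_derivative H x z" "c > 0"
  shows "c *\<^sub>R w \<in> graphical_derivative H x (c *\<^sub>R z)"
proof -
  obtain t h where t: "\<forall>k. 0 < t k" "t \<longlonglongrightarrow> 0" and h: "h \<longlonglongrightarrow> z"
    and q: "(\<lambda>k. (H (x + t k *\<^sub>R h k) - H x) /\<^sub>R t k) \<longlonglongrightarrow> w"
    using assms(1) unfolding graphical_derivative_def by blast
  have 1: "(\<lambda>k. t k / c) \<longlonglongrightarrow> 0"
    using tendsto_divide[OF t(2) tendsto_const, of c] assms by simp
  have 2: "(\<lambda>k. c *\<^sub>R h k) \<longlonglongrightarrow> c *\<^sub>R z" by (intro tendsto_intros h)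
  have "(\<lambda>k. c *\<^sub>R ((H (x + t k *\<^sub>R h k) - H x) /\<^sub>R t k)) \<longlonglongrightarrow> c *\<^sub>R w"
    by (intro tendsto_intros q)
  then have 3: "(\<lambda>k. (H (x + (t k / c) *\<^sub>R (c *\<^sub>R h k)) - H x) /\<^sub>R (t k / c)) \<longlonglongrightarrow> c *\<^sub>R w"
    using assms(2) by (simp add: field_simps)
  show ?thesis unfolding graphical_derivative_def
    using 1 2 3 t(1) assms(2) by (intro CollectI exI[of _ "\<lambda>k. t k / c"] exI[of _ "\<lambda>k. c *\<^sub>R h k"]) auto
qed

text \<open>Elements of the graphical derivative are always produced in this way: bounded directions together
  with bounded difference quotients have a common cluster point.\<close>

lemma graphical_derivative_cluster_point:
  fixes H :: "'a::euclidean_space \<Rightarrow> 'b::euclidean_space"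
  assumes "\<And>k. 0 < t k" "t \<longlonglongrightarrow> 0"
    and "\<And>k. norm (h k) \<le> A" "\<And>k. norm ((H (x + t k *\<^sub>R h k) - H x) /\<^sub>R t k) \<le> B"
  obtains z w r where "strict_mono (r :: nat \<Rightarrow> nat)" "(h \<circ> r) \<longlonglongrightarrow> z"
    "(\<lambda>k. (H (x + t (r k) *\<^sub>R h (r k)) - H x) /\<^sub>R t (r k)) \<longlonglongrightarrow> w" "w \<in> graphical_derivative H x z"
proof -
  define q where "q = (\<lambda>k. (h k, (H (x + t k *\<^sub>R h k) - H x) /\<^sub>R t k))"
  have "norm (q k) \<le> A + B" for k
    unfolding q_def using assms(3,4)[of k] by (smt (verit) norm_Pair_le)
  then have "bounded (range q)" by (auto simp: bounded_iff)
  then obtain l r where r: "strict_mono r" and l: "(q \<circ> r) \<longlonglongrightarrow> l"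
    using bounded_imp_convergent_subsequence by blast
  have 1: "(h \<circ> r) \<longlonglongrightarrow> fst l" using tendsto_fst[OF l] by (simp add: q_def o_def)
  have 2: "(\<lambda>k. (H (x + t (r k) *\<^sub>R h (r k)) - H x) /\<^sub>R t (r k)) \<longlonglongrightarrow> snd l"
    using tendsto_snd[OF l] by (simp add: q_def o_def)
  have 3: "(t \<circ> r) \<longlonglongrightarrow> 0" using LIMSEQ_subseq_LIMSEQ[OF assms(2) r] .
  have "snd l \<in> graphical_derivative H x (fst l)"
    unfolding graphical_derivative_def using 1 2 3 assms(1)
    by (intro CollectI exI[of _ "t \<circ> r"] exI[of _ "h \<circ> r"]) (auto simp: o_def)
  with r 1 2 show ?thesis by (rule that)
qed

text \<open>The graphical derivative is positively homogeneous, so that smallness near the origin is a linear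
  bound. For \<open>z = 0\<close> every positive multiple of \<open>w\<close> is small, hence \<open>w = 0\<close>.\<close>

lemma norm_graphical_derivative_le:
  assumes small: "\<And>z w. w \<in> graphical_derivative H x z \<Longrightarrow> norm z \<le> \<delta> \<Longrightarrow> norm w \<le> 1"
    and "\<delta> > 0" and w: "w \<in> graphical_derivative H x z"
  shows "norm w \<le> norm z / \<delta>"
proof (cases "z = 0")
  case True
  have "norm w \<le> e" if "e > 0" for e
    using small[OF graphical_derivative_scaleR[OF w, of "1 / e"]] that True \<open>\<delta> > 0\<close>
    by (simp add: divide_simps)
  then show ?thesis using True field_le_epsilon[of "norm w" 0] by simp
next
  case False
  then have "norm ((\<delta> / norm z) *\<^sub>R w) \<le> 1"
    using \<open>\<delta> > 0\<close> by (intro small[OF graphical_derivative_scaleR[OF w]]) auto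
  then show ?thesis using False \<open>\<delta> > 0\<close> by (simp add: field_simps)
qed

text \<open>Rescaling increments by the size of the change of \<open>H\<close>, not by the length of the step, keeps
  both components bounded even when \<open>H\<close> is steep. A failure of the bound then yields a unit vector \<open>w\<close>
  in the graphical derivative in a direction of norm at most \<open>1 / M\<close>.\<close>

lemma calm_if_graphical_derivative_bounded:
  fixes H :: "'a::euclidean_space \<Rightarrow> 'b::euclidean_space"
  assumes H: "isCont H x" and "0 \<le> L" "L < M"
    and bound: "\<And>z w. w \<in> graphical_derivative H x z \<Longrightarrow> norm w \<le> L * norm z"
  shows "\<forall>\<^sub>F y in nhds x. norm (H y - H x) \<le> M * norm (y - x)"
proof (rule ccontr)
  assume "\<not> ?thesis"
  then have "\<exists>y. dist y x < inverse (real (Suc k)) \<and> M * norm (y - x) < norm (H y - H x)" for k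
    unfolding eventually_nhds_metric by (metis inverse_positive_iff_positive of_nat_0_less_iff zero_less_Suc not_le)
  then obtain y where y: "\<And>k. dist (y k) x < inverse (real (Suc k))"
    "\<And>k. M * norm (y k - x) < norm (H (y k) - H x)" by metis
  define s where "s = (\<lambda>k. norm (H (y k) - H x))"
  have M: "M > 0" using assms by simp
  have s: "s k > 0" for k
    using y(2)[of k] M unfolding s_def by (smt (verit) mult_nonneg_nonneg norm_ge_zero)
  have "(\<lambda>k. dist (y k) x) \<longlonglongrightarrow> 0"
    by (rule tendsto_sandwich[OF always_eventually always_eventually tendsto_const LIMSEQ_inverse_real_of_nat])
       (use y(1) in \<open>blast intro: less_imp_le zero_le_dist\<close>)+
  then have "y \<longlonglongrightarrow> x" by (rule tendsto_dist_iff[THEN iffD2])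
  from isCont_tendsto_compose[OF H this] have "s \<longlonglongrightarrow> norm (H x - H x)"
    unfolding s_def by (intro tendsto_intros)
  then have s0: "s \<longlonglongrightarrow> 0" by simp
  define h where "h = (\<lambda>k. (y k - x) /\<^sub>R s k)"
  have h: "norm (h k) \<le> 1 / M" for k
  proof -
    have "M * norm (y k - x) \<le> s k" using y(2)[of k] by (simp add: s_def)
    then show ?thesis unfolding h_def norm_scaleR using s[of k] M by (simp add: field_simps)
  qed
  have xh: "x + s k *\<^sub>R h k = y k" for k using s[of k] by (simp add: h_def)
  have q: "norm ((H (x + s k *\<^sub>R h k) - H x) /\<^sub>R s k) = 1" for k
    using s[of k] by (simp add: xh) (simp add: s_def)
  obtain z w r where r: "strict_mono r" "(h \<circ> r) \<longlonglongrightarrow> z"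
    "(\<lambda>k. (H (x + s (r k) *\<^sub>R h (r k)) - H x) /\<^sub>R s (r k)) \<longlonglongrightarrow> w"
    and zw: "w \<in> graphical_derivative H x z"
    by (rule graphical_derivative_cluster_point[of s h "1 / M" H x 1, OF s s0 h eq_refl[OF q]]) blast
  have "norm z \<le> 1 / M"
    using h by (intro Lim_bounded[OF tendsto_norm[OF r(2)]]) auto
  moreover have "norm w = 1"
    using tendsto_norm[OF r(3)] q by (simp add: LIMSEQ_const_iff)
  ultimately have "1 \<le> L * (1 / M)"
    using bound[OF zw] \<open>0 \<le> L\<close> by (smt (verit) mult_left_mono)
  then show False using \<open>L < M\<close> M by (simp add: field_simps)
qed

lemma lipschitz_on_if_calm:
  fixes H :: "'a::real_normed_vector \<Rightarrow> 'b::real_normed_vector"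
  assumes "convex S" "continuous_on S H" "0 \<le> M"
    and calm: "\<And>x. x \<in> S \<Longrightarrow> \<forall>\<^sub>F y in nhds x. norm (H y - H x) \<le> M * norm (y - x)"
  shows "M-lipschitz_on S H"
proof (rule lipschitz_onI)
  fix x y assume xy: "x \<in> S" "y \<in> S"
  define p where "p = (\<lambda>t. x + t *\<^sub>R (y - x))"
  have pS: "p t \<in> S" if "t \<in> {0..1}" for t
    using convexD_alt[OF assms(1) xy, of t] that by (simp add: p_def algebra_simps)
  have "norm (H (p 1) - H (p 0) - (1 - 0) *\<^sub>R 0) \<le> (M * norm (y - x)) * (1 - 0)"
  proof (rule right_mean_value_inequality)
    show "continuous_on {0..1} (\<lambda>t. H (p t))"
      by (intro continuous_on_compose2[OF assms(2)]) (use pS in \<open>auto simp: p_def intro!: continuous_intros\<close>)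
    fix t :: real assume t: "t \<in> {0..<1}"
    have "(p \<longlongrightarrow> p t) (at_right t)" unfolding p_def by (intro tendsto_intros)
    moreover have "p t \<in> S" using pS t by auto
    ultimately have "\<forall>\<^sub>F s in at_right t. norm (H (p s) - H (p t)) \<le> M * norm (p s - p t)"
      using calm unfolding filterlim_iff by blast
    moreover have "\<forall>\<^sub>F s in at_right t. t < s" by (rule eventually_at_right_less)
    ultimately show "\<forall>\<^sub>F s in at_right t. norm (H (p s) - H (p t) - (s - t) *\<^sub>R 0)
        \<le> M * norm (y - x) * (s - t)"
    proof eventually_elim
      case (elim s)
      have "p s - p t = (s - t) *\<^sub>R (y - x)" by (simp add: p_def algebra_simps)
      then show ?case using elim by (simp add: mult_ac)
    qed
  qed auto
  then show "dist (H x) (H y) \<le> M * dist x y"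
    by (simp add: p_def dist_norm norm_minus_commute)
qed fact

text \<open>Cluster points of the difference quotients in direction \<open>Z\<close> belong to the graphical derivative, all
  of whose values are within \<open>B\<close> of \<open>C\<close>. Here \<open>C\<close> will be the increment of \<open>H\<close> over the full step \<open>Z\<close>.\<close>

lemma difference_quotient_near_chord:
  fixes H :: "'a::euclidean_space \<Rightarrow> 'b::euclidean_space"
  assumes S: "open S" and lip: "L-lipschitz_on S H" and x: "x \<in> S"
    and est: "\<And>v. v \<in> graphical_derivative H x Z \<Longrightarrow> norm (C - v) \<le> B" and "\<eta> > 0"
  shows "\<forall>\<^sub>F s in at_right 0. norm (H (x + s *\<^sub>R Z) - H x - s *\<^sub>R C) \<le> (B + \<eta>) * s"
proof (rule ccontr)
  assume neg: "\<not> ?thesis"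
  have "((\<lambda>s. x + s *\<^sub>R Z) \<longlongrightarrow> x + 0 *\<^sub>R Z) (at_right 0)" by (intro tendsto_intros)
  then have "\<forall>\<^sub>F s in at_right 0. x + s *\<^sub>R Z \<in> S"
    using S x by (intro topological_tendstoD) auto
  with neg have "\<exists>\<^sub>F s in at_right 0. x + s *\<^sub>R Z \<in> S \<and>
      \<not> norm (H (x + s *\<^sub>R Z) - H x - s *\<^sub>R C) \<le> (B + \<eta>) * s"
    unfolding not_eventually by (rule frequently_eventually_conj)
  then have fr: "\<exists>s. 0 < s \<and> s < e \<and> x + s *\<^sub>R Z \<in> S \<and>
      \<not> norm (H (x + s *\<^sub>R Z) - H x - s *\<^sub>R C) \<le> (B + \<eta>) * s" if "e > 0" for e
    using that unfolding frequently_def eventually_at_right_field by auto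
  have "\<exists>s. 0 < s \<and> s < inverse (real (Suc k)) \<and> x + s *\<^sub>R Z \<in> S \<and>
      \<not> norm (H (x + s *\<^sub>R Z) - H x - s *\<^sub>R C) \<le> (B + \<eta>) * s" for k
    by (rule fr) simp
  then obtain s where s: "\<And>k. 0 < s k" "\<And>k. s k < inverse (real (Suc k))"
    "\<And>k. x + s k *\<^sub>R Z \<in> S"
    "\<And>k. \<not> norm (H (x + s k *\<^sub>R Z) - H x - s k *\<^sub>R C) \<le> (B + \<eta>) * s k" by metis
  have s0: "s \<longlonglongrightarrow> 0"
    by (rule tendsto_sandwich[OF always_eventually always_eventually tendsto_const LIMSEQ_inverse_real_of_nat])
       (use s(1,2) in \<open>blast intro: less_imp_le zero_le_dist\<close>)+
  have q: "norm ((H (x + s k *\<^sub>R Z) - H x) /\<^sub>R s k) \<le> L * norm Z" for k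
    unfolding norm_scaleR
    using lipschitz_onD[OF lip s(3) x, of k] s(1)[of k] by (simp add: dist_norm field_simps)
  obtain z w r where r: "strict_mono r" "((\<lambda>k. Z) \<circ> r) \<longlonglongrightarrow> z"
    "(\<lambda>k. (H (x + s (r k) *\<^sub>R Z) - H x) /\<^sub>R s (r k)) \<longlonglongrightarrow> w"
    and zw: "w \<in> graphical_derivative H x z"
    by (rule graphical_derivative_cluster_point[of s "\<lambda>k. Z" "norm Z" H x "L * norm Z",
        OF s(1) s0 order_refl q]) blast
  have "z = Z" using r(2) by (simp add: o_def LIMSEQ_const_iff)
  then have "norm (C - w) \<le> B" using est zw by simp
  moreover have "B + \<eta> \<le> norm (w - C)"
  proof (rule tendsto_lowerbound[OF tendsto_norm[OF tendsto_diff[OF r(3) tendsto_const[of C]]]])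
    show "\<forall>\<^sub>F k in sequentially. B + \<eta> \<le> norm ((H (x + s (r k) *\<^sub>R Z) - H x) /\<^sub>R s (r k) - C)"
    proof (rule always_eventually, rule allI)
      fix k
      have eq: "(H (x + s (r k) *\<^sub>R Z) - H x) /\<^sub>R s (r k) - C =
         (H (x + s (r k) *\<^sub>R Z) - H x - s (r k) *\<^sub>R C) /\<^sub>R s (r k)"
        using s(1)[of "r k"] by (simp add: algebra_simps)
      show "B + \<eta> \<le> norm ((H (x + s (r k) *\<^sub>R Z) - H x) /\<^sub>R s (r k) - C)"
        unfolding eq norm_scaleR using s(1,4)[of "r k"] by (simp add: field_simps)
    qed
  qed simp
  ultimately show False using \<open>\<eta> > 0\<close> by (simp add: norm_minus_commute)
qed

text \<open>This removes the graphical derivative from the linearization estimate: a short chord of \<open>H\<close>,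
  rescaled, differs from the long chord in the same direction by essentially the factor \<open>\<alpha>\<close>. The bound
  is uniform in \<open>x\<close>, which is what averaging over \<open>x\<close> requires. Along the short segment the base point of
  the long chord moves, which costs the term \<open>2 * L * \<tau>\<close>.\<close>

lemma short_chord_near_long_chord:
  fixes H :: "'a::euclidean_space \<Rightarrow> 'b::euclidean_space"
  assumes S: "open S" "convex S" and lip: "L-lipschitz_on S H"
    and est: "\<And>x y v. x \<in> S \<Longrightarrow> y \<in> S \<Longrightarrow> v \<in> graphical_derivative H x (y - x) \<Longrightarrow>
      norm (H y - H x - v) \<le> \<alpha> * norm (y - x)"
    and x: "x \<in> S" and xe: "x + (1 + \<tau>) *\<^sub>R Z \<in> S" and \<tau>: "0 \<le> \<tau>"
  shows "norm (H (x + \<tau> *\<^sub>R Z) - H x - \<tau> *\<^sub>R (H (x + Z) - H x)) \<le> (\<alpha> + 2 * L * \<tau>) * norm Z * \<tau>"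
proof -
  define p where "p = (\<lambda>t. x + t *\<^sub>R Z)"
  have pS: "p t \<in> S" if "0 \<le> t" "t \<le> 1 + \<tau>" for t
  proof -
    have "(1 - t / (1 + \<tau>)) *\<^sub>R x + (t / (1 + \<tau>)) *\<^sub>R (x + (1 + \<tau>) *\<^sub>R Z) \<in> S"
      using that \<tau> by (intro convexD_alt[OF S(2) x xe]) auto
    moreover have "(1 - t / (1 + \<tau>)) *\<^sub>R x + (t / (1 + \<tau>)) *\<^sub>R (x + (1 + \<tau>) *\<^sub>R Z) = p t"
      using \<tau> by (simp add: p_def scaleR_diff_left scaleR_add_right del: scaleR_collapse)
    ultimately show ?thesis by simp
  qed
  have L: "L \<ge> 0" using lip by (rule lipschitz_on_nonneg)
  have "norm (H (p \<tau>) - H (p 0) - (\<tau> - 0) *\<^sub>R (H (p 1) - H (p 0))) \<le>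
     (\<alpha> * norm Z + \<eta> + 2 * L * \<tau> * norm Z) * (\<tau> - 0)" if \<eta>: "\<eta> > 0" for \<eta>
  proof (rule right_mean_value_inequality)
    show "continuous_on {0..\<tau>} (\<lambda>t. H (p t))"
      by (rule continuous_on_compose2[OF lipschitz_on_continuous_on[OF lip]])
         (use pS in \<open>auto simp: p_def intro!: continuous_intros\<close>)
    fix t :: real assume t: "t \<in> {0..<\<tau>}"
    have ptS: "p t \<in> S" "p (t + 1) \<in> S" "p 1 \<in> S" "p 0 \<in> S" using pS t by auto
    have pt1: "p (t + 1) = p t + Z" by (simp add: p_def algebra_simps)
    have "\<forall>\<^sub>F s in at_right 0. norm (H (p t + s *\<^sub>R Z) - H (p t) - s *\<^sub>R (H (p (t + 1)) - H (p t)))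
       \<le> (\<alpha> * norm Z + \<eta>) * s"
    proof (rule difference_quotient_near_chord[OF S(1) lip ptS(1) _ \<eta>])
      fix v assume "v \<in> graphical_derivative H (p t) Z"
      then show "norm (H (p (t + 1)) - H (p t) - v) \<le> \<alpha> * norm Z"
        using est[OF ptS(1,2), of v] by (simp add: pt1)
    qed
    then have "\<forall>\<^sub>F s in at_right t. norm (H (p t + (s - t) *\<^sub>R Z) - H (p t) - (s - t) *\<^sub>R (H (p (t + 1)) - H (p t)))
       \<le> (\<alpha> * norm Z + \<eta>) * (s - t)"
      by (subst eventually_at_right_to_0) simp
    moreover have "\<forall>\<^sub>F s in at_right t. t < s" by (rule eventually_at_right_less)
    ultimately show "\<forall>\<^sub>F s in at_right t. norm (H (p s) - H (p t) - (s - t) *\<^sub>R (H (p 1) - H (p 0)))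
       \<le> (\<alpha> * norm Z + \<eta> + 2 * L * \<tau> * norm Z) * (s - t)"
    proof eventually_elim
      case (elim s)
      have ps: "p t + (s - t) *\<^sub>R Z = p s" by (simp add: p_def algebra_simps)
      have d: "norm (p (t + 1) - p 1) = t * norm Z" "norm (p t - p 0) = t * norm Z"
        using t by (simp_all add: p_def algebra_simps flip: scaleR_left_diff_distrib)
      have "norm ((H (p (t + 1)) - H (p t)) - (H (p 1) - H (p 0)))
         = norm ((H (p (t + 1)) - H (p 1)) - (H (p t) - H (p 0)))" by (simp add: algebra_simps)
      also have "\<dots> \<le> norm (H (p (t + 1)) - H (p 1)) + norm (H (p t) - H (p 0))"
        by (rule norm_triangle_ineq4)
      also have "\<dots> \<le> L * (t * norm Z) + L * (t * norm Z)"
        using lipschitz_onD[OF lip ptS(2,3)] lipschitz_onD[OF lip ptS(1,4)] d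
        by (simp add: dist_norm)
      also have "\<dots> \<le> 2 * L * \<tau> * norm Z"
        using t L by (simp add: mult_left_mono mult_right_mono algebra_simps)
      finally have 1: "norm ((H (p (t + 1)) - H (p t)) - (H (p 1) - H (p 0))) \<le> 2 * L * \<tau> * norm Z" .
      have "norm (H (p s) - H (p t) - (s - t) *\<^sub>R (H (p 1) - H (p 0))) =
        norm ((H (p s) - H (p t) - (s - t) *\<^sub>R (H (p (t + 1)) - H (p t))) +
          (s - t) *\<^sub>R ((H (p (t + 1)) - H (p t)) - (H (p 1) - H (p 0))))"
        by (simp add: algebra_simps)
      also have "\<dots> \<le> (\<alpha> * norm Z + \<eta>) * (s - t) + (s - t) * (2 * L * \<tau> * norm Z)"
        using elim 1 unfolding ps by (intro norm_triangle_mono) auto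
      finally show ?case by (simp add: algebra_simps)
    qed
  qed (use \<tau> in auto)
  then have *: "norm (H (x + \<tau> *\<^sub>R Z) - H x - \<tau> *\<^sub>R (H (x + Z) - H x)) \<le>
    (\<alpha> + 2 * L * \<tau>) * norm Z * \<tau> + \<eta> * \<tau>" if "\<eta> > 0" for \<eta>
    using that by (simp add: p_def algebra_simps)
  show ?thesis
  proof (cases "\<tau> = 0")
    case False
    show ?thesis
    proof (rule field_le_epsilon)
      fix e :: real assume "e > 0"
      with False \<tau> show "norm (H (x + \<tau> *\<^sub>R Z) - H x - \<tau> *\<^sub>R (H (x + Z) - H x)) \<le>
          (\<alpha> + 2 * L * \<tau>) * norm Z * \<tau> + e"
        using *[of "e / \<tau>"] by simp
    qed
  qed simp
qed

section \<open>Consequences of metric regularity\<close>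

text \<open>The value \<open>\<infinity>\<close> of the distance to the empty set makes nearby equations solvable, and the preimage of a
  point is closed, so that the distance is attained.\<close>

lemma metrically_regular_around_solvable:
  fixes H :: "'a::euclidean_space \<Rightarrow> 'b::euclidean_space"
  assumes "metrically_regular_around H \<mu> x" and H: "continuous_on UNIV H"
  obtains V where "open V" "H x \<in> V" "\<And>y. y \<in> V \<Longrightarrow> \<exists>u. H u = y \<and> norm (u - x) \<le> \<mu> * norm (y - H x)"
proof -
  obtain U V where UV: "x \<in> U" "open V" "H x \<in> V"
    and reg: "\<And>y. y \<in> V \<Longrightarrow> ext_dist x (H -` {y}) \<le> ereal (\<mu> * norm (y - H x))"
    using assms(1) unfolding metrically_regular_around_def by blast
  show ?thesis
  proof (rule that[OF UV(2,3)])
    fix y assume y: "y \<in> V"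
    have "closed (H -` {y})" using H by (simp add: closed_vimage)
    moreover have "H -` {y} \<noteq> {}"
      using reg[OF y] by (auto simp: ext_dist_def top_ereal_def)
    ultimately obtain u where u: "u \<in> H -` {y}" "\<And>v. v \<in> H -` {y} \<Longrightarrow> dist x u \<le> dist x v"
      using distance_attains_inf by metis
    have "ereal (dist x u) \<le> ext_dist x (H -` {y})"
      unfolding ext_dist_def by (rule INF_greatest) (simp add: u(2))
    then have "ereal (dist x u) \<le> ereal (\<mu> * norm (y - H x))" using reg[OF y] by (rule order_trans)
    with u show "\<exists>u. H u = y \<and> norm (u - x) \<le> \<mu> * norm (y - H x)"
      by (auto simp: dist_norm norm_minus_commute)
  qed
qed

text \<open>Solve \<open>H u = H x + s *\<^sub>R w\<close> with the distance from \<open>u\<close> to \<open>x\<close> controlled by regularity and let \<open>s\<close> tend to 0.\<close>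

lemma graphical_derivative_surjective:
  fixes H :: "'a::euclidean_space \<Rightarrow> 'b::euclidean_space"
  assumes "metrically_regular_around H \<mu> x" and H: "continuous_on UNIV H"
  obtains z where "w \<in> graphical_derivative H x z" "norm z \<le> \<mu> * norm w"
proof -
  obtain V where V: "open V" "H x \<in> V"
    "\<And>y. y \<in> V \<Longrightarrow> \<exists>u. H u = y \<and> norm (u - x) \<le> \<mu> * norm (y - H x)"
    using metrically_regular_around_solvable[OF assms] by metis
  define t where "t = (\<lambda>k. inverse (real (Suc k)))"
  have t: "t k > 0" for k by (simp add: t_def)
  have t0: "t \<longlonglongrightarrow> 0" unfolding t_def by (rule LIMSEQ_inverse_real_of_nat)
  have "(\<lambda>k. H x + t k *\<^sub>R w) \<longlonglongrightarrow> H x + 0 *\<^sub>R w" by (intro tendsto_intros t0)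
  then have "\<forall>\<^sub>F k in sequentially. H x + t k *\<^sub>R w \<in> V"
    using V by (intro topological_tendstoD) auto
  then obtain N where N: "\<And>k. k \<ge> N \<Longrightarrow> H x + t k *\<^sub>R w \<in> V"
    unfolding eventually_sequentially by blast
  define s where "s = (\<lambda>k. t (k + N))"
  have s: "s k > 0" for k by (simp add: s_def t)
  have s0: "s \<longlonglongrightarrow> 0" unfolding s_def by (rule LIMSEQ_ignore_initial_segment[OF t0])
  have "\<exists>u. H u = H x + s k *\<^sub>R w \<and> norm (u - x) \<le> \<mu> * norm (s k *\<^sub>R w)" for k
    using V(3)[OF N[of "k + N"]] by (simp add: s_def)
  then obtain u where u: "\<And>k. H (u k) = H x + s k *\<^sub>R w"
    "\<And>k. norm (u k - x) \<le> \<mu> * norm (s k *\<^sub>R w)" by metis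
  define h where "h = (\<lambda>k. (u k - x) /\<^sub>R s k)"
  have xh: "x + s k *\<^sub>R h k = u k" for k using s[of k] by (simp add: h_def)
  have h: "norm (h k) \<le> \<mu> * norm w" for k
    unfolding h_def norm_scaleR using u(2)[of k] s[of k] by (simp add: field_simps)
  have q: "(H (x + s k *\<^sub>R h k) - H x) /\<^sub>R s k = w" for k
    using s[of k] by (simp add: xh u(1))
  have q': "norm ((H (x + s k *\<^sub>R h k) - H x) /\<^sub>R s k) \<le> norm w" for k
    unfolding q by simp
  obtain z w' r where r: "strict_mono r" "(h \<circ> r) \<longlonglongrightarrow> z"
    "(\<lambda>k. (H (x + s (r k) *\<^sub>R h (r k)) - H x) /\<^sub>R s (r k)) \<longlonglongrightarrow> w'"
    and zw: "w' \<in> graphical_derivative H x z"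
    by (rule graphical_derivative_cluster_point[of s h "\<mu> * norm w" H x "norm w", OF s s0 h q']) blast
  have "w' = w" using r(3) unfolding q by (simp add: LIMSEQ_const_iff)
  moreover have "norm z \<le> \<mu> * norm w"
    using h by (intro Lim_bounded[OF tendsto_norm[OF r(2)]]) auto
  ultimately show ?thesis using that zw by simp
qed

section \<open>Local injectivity\<close>

text \<open>A hyperplane separating \<open>G v - G u\<close> from the closure of \<open>C\<close> would contradict the scalar mean value
  theorem.\<close>

lemma closure_convex_mean_value:
  fixes G :: "'a::real_normed_vector \<Rightarrow> 'b::euclidean_space"
  assumes "convex C"
    and der: "\<And>x. x \<in> closed_segment u v \<Longrightarrow> (G has_derivative D x) (at x)"
    and C: "\<And>x. x \<in> closed_segment u v \<Longrightarrow> D x (v - u) \<in> C"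
  shows "G v - G u \<in> closure C"
proof (rule ccontr)
  assume "\<not> ?thesis"
  then obtain a b where ab: "a \<bullet> (G v - G u) < b" "\<And>x. x \<in> closure C \<Longrightarrow> a \<bullet> x > b"
    using separating_hyperplane_closed_point[of "closure C" "G v - G u"] convex_closure[OF assms(1)] by auto
  define p where "p = (\<lambda>t. u + t *\<^sub>R (v - u))"
  have p: "p t \<in> closed_segment u v" if "t \<in> {0..1}" for t
    using that by (auto simp: p_def in_segment algebra_simps)
  have pd: "((\<lambda>t. a \<bullet> G (p t)) has_derivative (\<lambda>h. a \<bullet> D (p t) (h *\<^sub>R (v - u)))) (at t)"
    if "t \<in> {0..1}" for t
  proof -
    have "(p has_derivative (\<lambda>h. h *\<^sub>R (v - u))) (at t)"
      unfolding p_def by (auto intro!: derivative_eq_intros)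
    from has_derivative_compose[OF this der[OF p[OF that]]] show ?thesis
      by (rule has_derivative_inner_right)
  qed
  have "\<exists>t\<in>{0<..<1::real}. a \<bullet> G (p 1) - a \<bullet> G (p 0) = (\<lambda>h. a \<bullet> D (p t) (h *\<^sub>R (v - u))) (1 - 0)"
    by (rule mvt_simple) (use pd in \<open>auto intro: has_derivative_at_withinI\<close>)
  then obtain t where t: "t \<in> {0<..<1}" "a \<bullet> (G v - G u) = a \<bullet> D (p t) (v - u)"
    by (auto simp: p_def inner_diff_right)
  have "D (p t) (v - u) \<in> closure C" using C[OF p[of t]] t(1) closure_subset by auto
  then show False using ab t(2) by fastforce
qed

text \<open>If every vector \<open>w\<close> of length \<open>\<sigma>\<close> is nearly hit by a short vector, testing with \<open>w\<close> itself shows that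
  the adjoint of \<open>D\<close> is bounded below. Since domain and codomain coincide, the adjoint is then onto, and
  the same lower bound holds for \<open>D\<close>. Equality of the dimensions is indispensable here.\<close>

lemma linear_lower_bound_if_nearly_onto:
  fixes D :: "'a::euclidean_space \<Rightarrow> 'a"
  assumes D: "linear D" and "\<sigma> > 0" "\<mu> > 0" "\<kappa> < 1"
    and z: "\<And>w. norm w = \<sigma> \<Longrightarrow> norm (z w) \<le> \<mu> * \<sigma> \<and> norm (w - D (z w)) \<le> \<kappa> * \<sigma>"
  shows "(1 - \<kappa>) * norm e \<le> \<mu> * norm (D e)"
proof -
  let ?T = "adjoint D"
  have lower: "(1 - \<kappa>) * norm w \<le> \<mu> * norm (?T w)" for w
  proof (cases "w = 0")
    case False
    define y where "y = (\<sigma> / norm w) *\<^sub>R w"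
    have y: "norm y = \<sigma>" using False \<open>\<sigma> > 0\<close> by (simp add: y_def)
    have "w \<bullet> (y - D (z y)) \<le> norm w * (\<kappa> * \<sigma>)"
      using norm_cauchy_schwarz[of w "y - D (z y)"] z[OF y] by (smt (verit) mult_left_mono norm_ge_zero)
    moreover have "w \<bullet> y = norm w * \<sigma>"
      using False by (simp add: y_def dot_square_norm power2_eq_square)
    moreover have "w \<bullet> D (z y) = z y \<bullet> ?T w"
      by (simp add: adjoint_works[OF D] inner_commute)
    moreover have "z y \<bullet> ?T w \<le> (\<mu> * \<sigma>) * norm (?T w)"
      using norm_cauchy_schwarz[of "z y" "?T w"] z[OF y] by (smt (verit) mult_right_mono norm_ge_zero)
    ultimately have "\<sigma> * ((1 - \<kappa>) * norm w) \<le> \<sigma> * (\<mu> * norm (?T w))"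
      by (simp add: inner_diff_right algebra_simps)
    then show ?thesis using \<open>\<sigma> > 0\<close> by simp
  qed (use \<open>\<mu> > 0\<close> in simp)
  have T: "linear ?T" by (rule adjoint_linear[OF D])
  have "inj ?T"
    unfolding linear_injective_0[OF T]
  proof (intro allI impI)
    fix w assume "?T w = 0"
    then show "w = 0" using lower[of w] \<open>\<kappa> < 1\<close> by (auto simp: mult_le_0_iff)
  qed
  then have "surj ?T" using T linear_injective_imp_surjective by blast
  then obtain w where w: "e = ?T w" by (metis surjD)
  have "norm e ^ 2 = D e \<bullet> w"
    by (metis adjoint_works[OF D] dot_square_norm w)
  also have "\<dots> \<le> norm (D e) * norm w" by (rule norm_cauchy_schwarz)
  finally have "(1 - \<kappa>) * norm e ^ 2 \<le> norm (D e) * ((1 - \<kappa>) * norm w)"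
    using \<open>\<kappa> < 1\<close> by (simp add: mult_left_mono mult.left_commute)
  also have "\<dots> \<le> norm (D e) * (\<mu> * norm e)"
    using lower[of w] w by (intro mult_left_mono) auto
  finally have "norm e * ((1 - \<kappa>) * norm e) \<le> norm e * (\<mu> * norm (D e))"
    by (simp add: power2_eq_square mult_ac)
  then show ?thesis
    by (cases "e = 0") (use \<open>\<mu> > 0\<close> in auto)
qed

text \<open>The mollification inherits the chord estimate. Being differentiable, it satisfies the linearization
  estimate with a genuine linear map in place of the graphical derivative. Radius \<open>4 * R\<close> leaves room for
  the offset of \<open>x\<close>, the averaging radius, and a chord of length at most \<open>2 * R\<close>.\<close>

lemma bump_average_derivative_near_chord:
  fixes H :: "'a::euclidean_space \<Rightarrow> 'b::euclidean_space"
  assumes H: "continuous_on UNIV H" and lip: "L-lipschitz_on (ball p (4 * R)) H"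
    and est: "\<And>x y v. x \<in> ball p (4 * R) \<Longrightarrow> y \<in> ball p (4 * R) \<Longrightarrow>
      v \<in> graphical_derivative H x (y - x) \<Longrightarrow> norm (H y - H x - v) \<le> \<alpha> * norm (y - x)"
    and \<delta>: "0 < \<delta>" "\<delta> \<le> R" and x: "x \<in> ball p R" and Z: "norm Z \<le> R"
    and D: "((\<lambda>x. bump_average \<delta> (\<lambda>q. H (x + q))) has_derivative D) (at x)"
  shows "norm (bump_average \<delta> (\<lambda>q. H (x + Z + q)) - bump_average \<delta> (\<lambda>q. H (x + q)) - D Z) \<le> \<alpha> * norm Z"
proof -
  define G where "G = (\<lambda>x. bump_average \<delta> (\<lambda>q. H (x + q)))"
  have cont: "continuous_on UNIV (\<lambda>q. H (y + q))" for y
    by (intro continuous_on_compose2[OF H] continuous_intros) auto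
  have quot: "norm (G (x + \<tau> *\<^sub>R Z) - G x - \<tau> *\<^sub>R (G (x + Z) - G x)) \<le> (\<alpha> + 2 * L * \<tau>) * norm Z * \<tau>"
    if \<tau>: "0 < \<tau>" "\<tau> < 1" for \<tau>
  proof -
    let ?g = "\<lambda>q. H (x + \<tau> *\<^sub>R Z + q) - H (x + q) - \<tau> *\<^sub>R (H (x + Z + q) - H (x + q))"
    have "norm (bump_average \<delta> ?g) \<le> (\<alpha> + 2 * L * \<tau>) * norm Z * \<tau>"
    proof (rule norm_bump_average_le[OF \<delta>(1)])
      show "continuous_on UNIV ?g" by (intro continuous_intros cont)
      fix q :: 'a assume q: "norm q < \<delta>"
      have "norm (x - p) < R" using x by (simp add: dist_norm norm_minus_commute)
      then have 1: "norm (x + q - p) < 2 * R"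
        using norm_triangle_ineq[of "x - p" q] q \<delta> by (simp add: algebra_simps)
      have "norm ((1 + \<tau>) *\<^sub>R Z) \<le> 2 * R"
        using Z \<tau> mult_mono[of "1 + \<tau>" 2 "norm Z" R] by simp
      then have 2: "norm (x + q + (1 + \<tau>) *\<^sub>R Z - p) < 4 * R"
        using norm_triangle_ineq[of "x + q - p" "(1 + \<tau>) *\<^sub>R Z"] 1 by (simp add: algebra_simps)
      have "norm (H (x + q + \<tau> *\<^sub>R Z) - H (x + q) - \<tau> *\<^sub>R (H (x + q + Z) - H (x + q)))
        \<le> (\<alpha> + 2 * L * \<tau>) * norm Z * \<tau>"
        using 1 2 \<tau> \<delta> by (intro short_chord_near_long_chord[OF _ _ lip est])
           (auto simp: dist_norm norm_minus_commute)
      then show "norm (?g q) \<le> (\<alpha> + 2 * L * \<tau>) * norm Z * \<tau>"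
        by (simp add: add.assoc add.commute[of q])
    qed
    also have "bump_average \<delta> ?g = G (x + \<tau> *\<^sub>R Z) - G x - \<tau> *\<^sub>R (G (x + Z) - G x)"
    proof -
      have c: "continuous_on UNIV (\<lambda>q. H (x + \<tau> *\<^sub>R Z + q) - H (x + q))"
        "continuous_on UNIV (\<lambda>q. \<tau> *\<^sub>R (H (x + Z + q) - H (x + q)))"
        by (intro continuous_intros cont)+
      show ?thesis
        by (simp only: G_def bump_average_diff[OF c] bump_average_diff[OF cont cont] bump_average_scaleR)
    qed
    finally show ?thesis .
  qed
  have lim: "((\<lambda>\<tau>. (G (x + \<tau> *\<^sub>R Z) - G x) /\<^sub>R \<tau>) \<longlongrightarrow> D Z) (at_right 0)"
  proof -
    have "((\<lambda>\<tau>. x + \<tau> *\<^sub>R Z) has_derivative (\<lambda>h. h *\<^sub>R Z)) (at 0)"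
      by (auto intro!: derivative_eq_intros)
    from has_derivative_compose[OF this, of G D] D
    have "((\<lambda>\<tau>. G (x + \<tau> *\<^sub>R Z)) has_derivative (\<lambda>h. D (h *\<^sub>R Z))) (at 0)"
      by (simp add: G_def)
    moreover have "(\<lambda>h. D (h *\<^sub>R Z)) = (\<lambda>h. h *\<^sub>R D Z)"
      using linear_cmul[OF has_derivative_linear[OF D]] by (simp add: fun_eq_iff)
    ultimately have "((\<lambda>\<tau>. G (x + \<tau> *\<^sub>R Z)) has_vector_derivative D Z) (at 0)"
      by (simp add: has_vector_derivative_def)
    then have "((\<lambda>\<tau>. norm (G (x + \<tau> *\<^sub>R Z) - G x - \<tau> *\<^sub>R D Z) / norm \<tau>) \<longlongrightarrow> 0) (at 0)"
      by (simp add: has_vector_derivative_def has_derivative_iff_norm)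
    then have "((\<lambda>\<tau>. norm (G (x + \<tau> *\<^sub>R Z) - G x - \<tau> *\<^sub>R D Z) / norm \<tau>) \<longlongrightarrow> 0) (at_right 0)"
      by (rule tendsto_mono[rotated]) (simp add: at_le)
    moreover have "\<forall>\<^sub>F \<tau> in at_right 0. norm (G (x + \<tau> *\<^sub>R Z) - G x - \<tau> *\<^sub>R D Z) / norm \<tau> =
        norm ((G (x + \<tau> *\<^sub>R Z) - G x) /\<^sub>R \<tau> - D Z)"
      using eventually_at_right_less[of 0]
    proof eventually_elim
      case (elim \<tau>)
      have "(G (x + \<tau> *\<^sub>R Z) - G x) /\<^sub>R \<tau> - D Z = (G (x + \<tau> *\<^sub>R Z) - G x - \<tau> *\<^sub>R D Z) /\<^sub>R \<tau>"
        using elim by (simp add: scaleR_diff_right)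
      then show ?case by (simp add: divide_inverse_commute)
    qed
    ultimately have "((\<lambda>\<tau>. norm ((G (x + \<tau> *\<^sub>R Z) - G x) /\<^sub>R \<tau> - D Z)) \<longlongrightarrow> 0) (at_right 0)"
      by (rule Lim_transform_eventually)
    then show ?thesis by (simp add: tendsto_norm_zero_iff LIM_zero_iff)
  qed
  have "norm (D Z - (G (x + Z) - G x)) \<le> (\<alpha> + 2 * L * 0) * norm Z"
  proof (rule tendsto_le[OF trivial_limit_at_right_real])
    show "((\<lambda>\<tau>. (\<alpha> + 2 * L * \<tau>) * norm Z) \<longlongrightarrow> (\<alpha> + 2 * L * 0) * norm Z) (at_right 0)"
      by (intro tendsto_intros)
    show "((\<lambda>\<tau>. norm ((G (x + \<tau> *\<^sub>R Z) - G x) /\<^sub>R \<tau> - (G (x + Z) - G x))) \<longlongrightarrow>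
        norm (D Z - (G (x + Z) - G x))) (at_right 0)"
      by (intro tendsto_intros lim)
    have "\<forall>\<^sub>F \<tau> in at_right 0. \<tau> \<in> {0<..<1::real}" by (rule eventually_at_right_real) simp
    then show "\<forall>\<^sub>F \<tau> in at_right 0. norm ((G (x + \<tau> *\<^sub>R Z) - G x) /\<^sub>R \<tau> - (G (x + Z) - G x))
        \<le> (\<alpha> + 2 * L * \<tau>) * norm Z"
    proof eventually_elim
      case (elim \<tau>)
      have "(G (x + \<tau> *\<^sub>R Z) - G x) /\<^sub>R \<tau> - (G (x + Z) - G x) =
        (G (x + \<tau> *\<^sub>R Z) - G x - \<tau> *\<^sub>R (G (x + Z) - G x)) /\<^sub>R \<tau>"
        using elim by (simp add: scaleR_diff_right)
      then show ?case using quot[of \<tau>] elim by (simp add: pos_divide_le_eq divide_inverse_commute[symmetric])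
    qed
  qed
  then show ?thesis by (simp add: G_def norm_minus_commute)
qed

text \<open>Near \<open>p\<close>, the derivatives of fine mollifications \<open>G\<close> approximate increments of \<open>H\<close> at the fixed scale
  \<open>\<sigma>\<close> up to the factor \<open>\<alpha>\<close>, while regularity represents each \<open>w\<close> of length \<open>\<sigma>\<close> as such an increment over
  a step of length at most \<open>\<mu> * \<sigma>\<close>. Hence each derivative is nearly onto, because \<open>\<alpha> * \<mu> < 1\<close>.
  With the steps \<open>z w\<close> chosen once and for all, independently of the base point, this property is convex
  in the linear map, so that it survives the averaging of derivatives along a segment in the mean value
  theorem. Therefore \<open>G\<close> expands distances by a factor independent of the averaging radius, and so does \<open>H\<close>.
  Invertibility of the individual derivatives would not be enough.\<close>

lemma locally_expanding:
  fixes H :: "'a::euclidean_space \<Rightarrow> 'a"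
  assumes H: "continuous_on UNIV H" and R: "R > 0" and lip: "L-lipschitz_on (ball p (4 * R)) H"
    and est: "\<And>x y v. x \<in> ball p (4 * R) \<Longrightarrow> y \<in> ball p (4 * R) \<Longrightarrow>
      v \<in> graphical_derivative H x (y - x) \<Longrightarrow> norm (H y - H x - v) \<le> \<alpha> * norm (y - x)"
    and "\<mu> > 0" "\<alpha> > 0" "\<alpha> * \<mu> < 1"
    and reg: "metrically_regular_around H \<mu> p"
  obtains \<rho> c where "\<rho> > 0" "c > 0"
    "\<And>u v. u \<in> ball p \<rho> \<Longrightarrow> v \<in> ball p \<rho> \<Longrightarrow> c * norm (v - u) \<le> norm (H v - H u)"
proof -
  obtain V where V: "open V" "H p \<in> V"
    "\<And>y. y \<in> V \<Longrightarrow> \<exists>u. H u = y \<and> norm (u - p) \<le> \<mu> * norm (y - H p)"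
    using metrically_regular_around_solvable[OF reg H] by metis
  obtain e where e: "e > 0" "ball (H p) e \<subseteq> V" using V(1,2) open_contains_ball by blast
  define \<sigma> where "\<sigma> = min (e / 2) (R / \<mu>)"
  have \<sigma>: "\<sigma> > 0" "\<sigma> < e" "\<mu> * \<sigma> \<le> R"
    using e R \<open>\<mu> > 0\<close> by (auto simp: \<sigma>_def min_def field_simps)
  have "\<exists>z. H (p + z) = H p + w \<and> norm z \<le> \<mu> * \<sigma>" if "norm w = \<sigma>" for w
  proof -
    have "H p + w \<in> V" using that \<sigma> e(2) by (auto simp: dist_norm)
    then obtain u where "H u = H p + w" "norm (u - p) \<le> \<mu> * norm w" using V(3) by fastforce
    then show ?thesis using that by (intro exI[of _ "u - p"]) auto
  qed
  then obtain z where z: "\<And>w. norm w = \<sigma> \<Longrightarrow> H (p + z w) = H p + w \<and> norm (z w) \<le> \<mu> * \<sigma>"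
    by metis
  \<comment> \<open>Halfway between \<open>\<alpha> * \<mu>\<close> and 1: the gap absorbs the errors from
    moving the base point and from averaging.\<close>
  define \<kappa> where "\<kappa> = (1 + \<alpha> * \<mu>) / 2"
  have \<kappa>: "\<kappa> < 1" using assms by (simp add: \<kappa>_def)
  have L: "L \<ge> 0" using lip by (rule lipschitz_on_nonneg)
  define \<rho> where "\<rho> = min R ((1 - \<alpha> * \<mu>) * \<sigma> / (8 * (L + 1)))"
  have \<rho>: "\<rho> > 0" "\<rho> \<le> R" using R \<sigma> L assms by (auto simp: \<rho>_def)
  have "\<rho> \<le> (1 - \<alpha> * \<mu>) * \<sigma> / (8 * (L + 1))" by (simp add: \<rho>_def)
  then have "4 * ((L + 1) * \<rho>) \<le> (1 - \<alpha> * \<mu>) * \<sigma> / 2" using L by (simp add: field_simps)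
  then have L\<rho>: "4 * (L * \<rho>) \<le> (1 - \<alpha> * \<mu>) * \<sigma> / 2" using \<rho> by (simp add: algebra_simps)
  define c where "c = (1 - \<kappa>) / \<mu>"
  have c: "c > 0" using \<kappa> \<open>\<mu> > 0\<close> by (simp add: c_def)
  have HL: "norm (H y - H x) \<le> L * norm (y - x)" if "norm (x - p) < 4 * R" "norm (y - p) < 4 * R" for x y
    using lipschitz_onD[OF lip, of y x] that by (simp add: dist_norm norm_minus_commute)
  have cont: "continuous_on UNIV (\<lambda>q. H (y + q))" for y
    by (intro continuous_on_compose2[OF H] continuous_intros) auto
  have main: "c * norm (v - u) \<le> norm (H v - H u) + 2 * L * \<delta>"
    if u: "u \<in> ball p \<rho>" and v: "v \<in> ball p \<rho>" and \<delta>: "0 < \<delta>" "\<delta> \<le> \<rho>" for u v \<delta>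
  proof -
    define G where "G = (\<lambda>x. bump_average \<delta> (\<lambda>q. H (x + q)))"
    have GH: "norm (G x - H x) \<le> L * \<delta>" if "norm (x - p) < 3 * R" for x
    proof -
      have "norm (bump_average \<delta> (\<lambda>q. H (x + q) - H x)) \<le> L * \<delta>"
      proof (rule norm_bump_average_le[OF \<delta>(1)])
        show "continuous_on UNIV (\<lambda>q. H (x + q) - H x)" by (intro continuous_intros cont)
        fix q :: 'a assume q: "norm q < \<delta>"
        have "norm (x + q - p) < 4 * R"
          using norm_triangle_ineq[of "x - p" q] q that \<delta> \<rho> by (simp add: algebra_simps)
        then have "norm (H (x + q) - H x) \<le> L * norm q" using HL[of x "x + q"] that R by simp
        also have "\<dots> \<le> L * \<delta>" using q L by (intro mult_left_mono) auto
        finally show "norm (H (x + q) - H x) \<le> L * \<delta>" .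
      qed
      also have "bump_average \<delta> (\<lambda>q. H (x + q) - H x) = G x - H x"
        by (simp add: G_def bump_average_diff[OF cont continuous_on_const] bump_average_const[OF \<delta>(1)])
      finally show ?thesis .
    qed
    define D where "D = (\<lambda>x. frechet_derivative G (at x))"
    have D: "(G has_derivative D x) (at x)" for x
      using bump_average_differentiable[OF \<delta>(1) H]
      unfolding D_def G_def by (simp add: frechet_derivative_works)
    define \<D> where "\<D> = {T. linear T \<and> (\<forall>w. norm w = \<sigma> \<longrightarrow> norm (w - T (z w)) \<le> \<kappa> * \<sigma>)}"
    have D\<D>: "D x \<in> \<D>" if x: "x \<in> ball p \<rho>" for x
      unfolding \<D>_def
    proof (intro CollectI conjI allI impI)
      show "linear (D x)" using D by (rule has_derivative_linear)
      fix w :: 'a assume w: "norm w = \<sigma>"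
      have zw: "H (p + z w) = H p + w" "norm (z w) \<le> \<mu> * \<sigma>" "norm (z w) \<le> R"
        using z[OF w] \<sigma>(3) by auto
      have xp: "norm (x - p) < \<rho>" using x by (simp add: dist_norm norm_minus_commute)
      have xz: "norm (x + z w - p) < 3 * R"
        using norm_triangle_ineq[of "x - p" "z w"] xp zw \<rho> by (simp add: algebra_simps)
      have 1: "norm (G (x + z w) - G x - D x (z w)) \<le> \<alpha> * norm (z w)"
        unfolding G_def
        by (rule bump_average_derivative_near_chord[OF H lip est])
           (use \<delta> \<rho> x zw D in \<open>auto simp: G_def\<close>)
      have 2: "norm (G (x + z w) - H (x + z w)) \<le> L * \<delta>" "norm (G x - H x) \<le> L * \<delta>"
        using GH[OF xz] GH[of x] xp \<rho> R by auto
      have 3: "norm (H (x + z w) - H (p + z w)) \<le> L * norm (x - p)" "norm (H x - H p) \<le> L * norm (x - p)"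
        using HL[of "p + z w" "x + z w"] HL[of p x] xz xp zw \<rho> R by auto
      have "norm (w - D x (z w)) = norm ((G (x + z w) - G x - D x (z w))
          - (G (x + z w) - H (x + z w)) + (G x - H x)
          - (H (x + z w) - H (p + z w)) + (H x - H p))"
        using zw(1) by (simp add: algebra_simps)
      also have "\<dots> \<le> norm (G (x + z w) - G x - D x (z w)) + norm (G (x + z w) - H (x + z w))
          + norm (G x - H x) + norm (H (x + z w) - H (p + z w)) + norm (H x - H p)"
        by (smt (verit, ccfv_threshold) norm_triangle_ineq norm_triangle_ineq4)
      also have "\<dots> \<le> \<alpha> * norm (z w) + 2 * (L * \<delta>) + 2 * (L * norm (x - p))"
        using 1 2 3 by linarith
      also have "\<dots> \<le> \<alpha> * (\<mu> * \<sigma>) + 2 * (L * \<rho>) + 2 * (L * \<rho>)"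
        using zw(2) \<delta> xp L \<open>\<alpha> > 0\<close> by (intro add_mono mult_left_mono) auto
      also have "\<dots> \<le> \<kappa> * \<sigma>" using L\<rho> by (simp add: \<kappa>_def field_simps)
      finally show "norm (w - D x (z w)) \<le> \<kappa> * \<sigma>" .
    qed
    define C where "C = (\<lambda>T. T (v - u)) ` \<D>"
    have "convex C"
      unfolding C_def convex_alt
    proof safe
      fix T1 T2 and t :: real assume T: "T1 \<in> \<D>" "T2 \<in> \<D>" and t: "0 \<le> t" "t \<le> 1"
      define T where "T = (\<lambda>x. (1 - t) *\<^sub>R T1 x + t *\<^sub>R T2 x)"
      have "T \<in> \<D>" unfolding \<D>_def
      proof (intro CollectI conjI allI impI)
        show "linear T" using T unfolding T_def \<D>_def
          by (auto intro!: linear_compose_add linear_compose_scale_right)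
        fix w :: 'a assume w: "norm w = \<sigma>"
        have "w - T (z w) = (1 - t) *\<^sub>R (w - T1 (z w)) + t *\<^sub>R (w - T2 (z w))"
          by (simp add: T_def algebra_simps)
        also have "norm \<dots> \<le> (1 - t) * (\<kappa> * \<sigma>) + t * (\<kappa> * \<sigma>)"
          using T w t by (intro norm_triangle_mono) (auto simp: \<D>_def mult_left_mono)
        finally show "norm (w - T (z w)) \<le> \<kappa> * \<sigma>" by (simp add: algebra_simps)
      qed
      then show "(1 - t) *\<^sub>R T1 (v - u) + t *\<^sub>R T2 (v - u) \<in> (\<lambda>T. T (v - u)) ` \<D>"
        by (intro image_eqI[of _ _ T]) (auto simp: T_def)
    qed
    moreover have "D x (v - u) \<in> C" if "x \<in> closed_segment u v" for x
    proof -
      have "x \<in> ball p \<rho>" using that u v closed_segment_subset[OF u v convex_ball] by auto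
      then show ?thesis using D\<D> by (auto simp: C_def)
    qed
    ultimately have "G v - G u \<in> closure C"
      using closure_convex_mean_value[of C u v G D] D by blast
    moreover have "closure C \<subseteq> {x. c * norm (v - u) \<le> norm x}"
    proof (rule closure_minimal)
      show "closed {x. c * norm (v - u) \<le> norm x}"
        by (intro closed_Collect_le continuous_intros)
      show "C \<subseteq> {x. c * norm (v - u) \<le> norm x}"
      proof
        fix x assume "x \<in> C"
        then obtain T where T: "T \<in> \<D>" "x = T (v - u)" by (auto simp: C_def)
        have "(1 - \<kappa>) * norm (v - u) \<le> \<mu> * norm (T (v - u))"
          by (rule linear_lower_bound_if_nearly_onto[OF _ \<sigma>(1) \<open>\<mu> > 0\<close> \<kappa>])
             (use T z in \<open>auto simp: \<D>_def\<close>)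
        then show "x \<in> {x. c * norm (v - u) \<le> norm x}"
          using T(2) \<open>\<mu> > 0\<close> by (simp add: c_def field_simps)
      qed
    qed
    ultimately have 1: "c * norm (v - u) \<le> norm (G v - G u)" by auto
    have "norm (G v - H v) \<le> L * \<delta>" "norm (G u - H u) \<le> L * \<delta>"
      using GH[of u] GH[of v] u v \<rho> R by (auto simp: dist_norm norm_minus_commute)
    moreover have "norm (G v - G u) \<le> norm (G v - H v) + norm (H v - H u) + norm (G u - H u)"
      using norm_triangle_ineq4[of "(G v - H v) + (H v - H u)" "G u - H u"]
        norm_triangle_ineq[of "G v - H v" "H v - H u"] by simp
    ultimately show ?thesis using 1 by simp
  qed
  have "c * norm (v - u) \<le> norm (H v - H u)" if uv: "u \<in> ball p \<rho>" "v \<in> ball p \<rho>" for u v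
  proof (rule field_le_epsilon)
    fix e :: real assume "e > 0"
    define \<delta> where "\<delta> = min \<rho> (e / (2 * (L + 1)))"
    have \<delta>: "0 < \<delta>" "\<delta> \<le> \<rho>" using \<rho> L \<open>e > 0\<close> by (auto simp: \<delta>_def)
    have "\<delta> \<le> e / (2 * (L + 1))" by (simp add: \<delta>_def)
    then have "2 * L * \<delta> + 2 * \<delta> \<le> e" using L by (simp add: field_simps)
    with main[OF uv \<delta>] \<delta> show "c * norm (v - u) \<le> norm (H v - H u) + e" by linarith
  qed
  with \<rho>(1) c show ?thesis by (rule that)
qed

text \<open>Regularity by itself controls only one of the solutions of \<open>H u = H v\<close>. When \<open>H\<close> is injective near \<open>x\<close>,
  that solution is \<open>v\<close> itself, and every direction is controlled.\<close>

lemma graphical_derivative_inverse_bound: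
  fixes H :: "'a::euclidean_space \<Rightarrow> 'b::euclidean_space"
  assumes H: "continuous_on UNIV H" and reg: "metrically_regular_around H \<mu> x"
    and "\<rho> > 0" and inj: "inj_on H (ball x \<rho>)"
    and w: "w \<in> graphical_derivative H x z"
  shows "norm z \<le> \<mu> * norm w"
proof -
  obtain t h where t: "\<And>k. 0 < t k" "t \<longlonglongrightarrow> 0" and h: "h \<longlonglongrightarrow> z"
    and q: "(\<lambda>k. (H (x + t k *\<^sub>R h k) - H x) /\<^sub>R t k) \<longlonglongrightarrow> w"
    using w unfolding graphical_derivative_def by blast
  obtain V where V: "open V" "H x \<in> V"
    "\<And>y. y \<in> V \<Longrightarrow> \<exists>u. H u = y \<and> norm (u - x) \<le> \<mu> * norm (y - H x)"
    using metrically_regular_around_solvable[OF reg H] by metis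
  define v where "v = (\<lambda>k. x + t k *\<^sub>R h k)"
  have "v \<longlonglongrightarrow> x + 0 *\<^sub>R z" unfolding v_def by (intro tendsto_intros t h)
  then have v: "v \<longlonglongrightarrow> x" by simp
  have Hv: "(\<lambda>k. H (v k)) \<longlonglongrightarrow> H x"
    using H v by (intro isCont_tendsto_compose[of x H]) (auto simp: continuous_on_eq_continuous_at)
  have "(\<lambda>k. \<mu> * norm (H (v k) - H x)) \<longlonglongrightarrow> \<mu> * norm (H x - H x)" by (intro tendsto_intros Hv)
  then have lim0: "(\<lambda>k. \<mu> * norm (H (v k) - H x)) \<longlonglongrightarrow> 0" by simp
  have "\<forall>\<^sub>F k in sequentially. v k \<in> ball x \<rho>"
    using v \<open>\<rho> > 0\<close> by (intro topological_tendstoD) auto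
  moreover have "\<forall>\<^sub>F k in sequentially. H (v k) \<in> V"
    using Hv V by (intro topological_tendstoD) auto
  moreover have "\<forall>\<^sub>F k in sequentially. \<mu> * norm (H (v k) - H x) < \<rho>"
    using lim0 \<open>\<rho> > 0\<close> by (rule order_tendstoD)
  ultimately have "\<forall>\<^sub>F k in sequentially. norm (h k) \<le> \<mu> * norm ((H (x + t k *\<^sub>R h k) - H x) /\<^sub>R t k)"
  proof eventually_elim
    case (elim k)
    obtain u where u: "H u = H (v k)" "norm (u - x) \<le> \<mu> * norm (H (v k) - H x)"
      using V(3) elim by blast
    have "u \<in> ball x \<rho>" using u(2) elim by (simp add: dist_norm norm_minus_commute)
    then have "u = v k" using inj u(1) elim by (auto dest: inj_onD)
    then have "t k * norm (h k) \<le> \<mu> * norm (H (v k) - H x)"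
      using u(2) t(1)[of k] by (simp add: v_def)
    then show ?case
      unfolding norm_scaleR using t(1)[of k] by (simp add: v_def field_simps)
  qed
  then show ?thesis
    by (intro tendsto_le[OF _ tendsto_mult[OF tendsto_const tendsto_norm[OF q]] tendsto_norm[OF h]]) auto
qed

section \<open>The reversed sign\<close>

text \<open>Take \<open>w\<close> of norm 1 in the graphical derivative in a direction \<open>Z\<close> of norm at most \<open>\<mu>\<close>. For
  suitable small \<open>t\<close>, the increment of \<open>H\<close> over the step \<open>t *\<^sub>R Z\<close> is close to \<open>t *\<^sub>R w\<close>, which is also an element
  of the graphical derivative in that direction. With the reversed sign the two add up instead of
  cancelling, and \<open>2 \<le> \<alpha> * norm Z \<le> \<alpha> * \<mu> < 1\<close>.\<close>

lemma reversed_estimate_impossible: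
  fixes H :: "'a::euclidean_space \<Rightarrow> 'a"
  assumes H: "continuous_on UNIV H" and reg: "metrically_regular_around H \<mu> x"
    and S: "open S" "x \<in> S" and lip: "L-lipschitz_on S H"
    and "\<mu> > 0" "\<alpha> * \<mu> < 1" "\<alpha> > 0"
    and est: "\<And>y v. y \<in> S \<Longrightarrow> v \<in> graphical_derivative H x (y - x) \<Longrightarrow>
      norm (H x - H y - v) \<le> \<alpha> * norm (x - y)"
  shows False
proof -
  obtain w :: 'a where w: "norm w = 1" using vector_choose_size[of 1] by auto
  obtain Z where Z: "w \<in> graphical_derivative H x Z" "norm Z \<le> \<mu> * norm w"
    using graphical_derivative_surjective[OF reg H] .
  obtain t h where t: "\<And>k. 0 < t k" "t \<longlonglongrightarrow> 0" and h: "h \<longlonglongrightarrow> Z"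
    and q: "(\<lambda>k. (H (x + t k *\<^sub>R h k) - H x) /\<^sub>R t k) \<longlonglongrightarrow> w"
    using Z(1) unfolding graphical_derivative_def by blast
  have "(\<lambda>k. x + t k *\<^sub>R h k) \<longlonglongrightarrow> x + 0 *\<^sub>R Z" by (intro tendsto_intros t h)
  then have "\<forall>\<^sub>F k in sequentially. x + t k *\<^sub>R h k \<in> S"
    using S by (intro topological_tendstoD) auto
  moreover have "(\<lambda>k. x + t k *\<^sub>R Z) \<longlonglongrightarrow> x + 0 *\<^sub>R Z" by (intro tendsto_intros t)
  then have "\<forall>\<^sub>F k in sequentially. x + t k *\<^sub>R Z \<in> S"
    using S by (intro topological_tendstoD) auto
  ultimately have "\<forall>\<^sub>F k in sequentially. norm (w + (H (x + t k *\<^sub>R h k) - H x) /\<^sub>R t k)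
     \<le> \<alpha> * norm Z + L * norm (h k - Z)"
  proof eventually_elim
    case (elim k)
    \<comment> \<open>Only along \<open>Z\<close> itself is \<open>t k *\<^sub>R w\<close> known to be in the graphical derivative; the
      Lipschitz bound then passes to the directions \<open>h k\<close>.\<close>
    have "norm (H x - H (x + t k *\<^sub>R Z) - t k *\<^sub>R w) \<le> \<alpha> * norm (x - (x + t k *\<^sub>R Z))"
      using elim graphical_derivative_scaleR[OF Z(1) t(1)[of k]] by (intro est) auto
    then have 1: "norm (t k *\<^sub>R w + (H (x + t k *\<^sub>R Z) - H x)) \<le> t k * (\<alpha> * norm Z)"
      using t(1)[of k] norm_minus_commute[of "H x" "t k *\<^sub>R w + H (x + t k *\<^sub>R Z)"]
      by (simp add: algebra_simps)
    have "norm (H (x + t k *\<^sub>R h k) - H (x + t k *\<^sub>R Z)) \<le> L * norm ((x + t k *\<^sub>R h k) - (x + t k *\<^sub>R Z))"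
      using lipschitz_onD[OF lip elim] by (simp add: dist_norm)
    also have "(x + t k *\<^sub>R h k) - (x + t k *\<^sub>R Z) = t k *\<^sub>R (h k - Z)" by (simp add: algebra_simps)
    finally have 2: "norm (H (x + t k *\<^sub>R h k) - H (x + t k *\<^sub>R Z)) \<le> t k * (L * norm (h k - Z))"
      using t(1)[of k] by (simp add: mult_ac)
    have eq: "w + (H (x + t k *\<^sub>R h k) - H x) /\<^sub>R t k =
      ((t k *\<^sub>R w + (H (x + t k *\<^sub>R Z) - H x)) + (H (x + t k *\<^sub>R h k) - H (x + t k *\<^sub>R Z))) /\<^sub>R t k"
      using t(1)[of k] by (simp add: algebra_simps)
    have "norm ((t k *\<^sub>R w + (H (x + t k *\<^sub>R Z) - H x)) + (H (x + t k *\<^sub>R h k) - H (x + t k *\<^sub>R Z)))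
      \<le> t k * (\<alpha> * norm Z) + t k * (L * norm (h k - Z))"
      using 1 2 by (rule norm_triangle_mono)
    then show ?case unfolding eq norm_scaleR using t(1)[of k] by (simp add: field_simps)
  qed
  moreover have "(\<lambda>k. \<alpha> * norm Z + L * norm (h k - Z)) \<longlonglongrightarrow> \<alpha> * norm Z + L * norm (Z - Z)"
    by (intro tendsto_intros h)
  ultimately have "norm (w + w) \<le> \<alpha> * norm Z + L * norm (Z - Z)"
    using tendsto_le[OF sequentially_bot _ tendsto_norm[OF tendsto_add[OF tendsto_const q]]] by blast
  then have "2 \<le> \<alpha> * norm Z" using w by (simp add: scaleR_2[symmetric])
  also have "\<dots> \<le> \<alpha> * \<mu>" using Z(2) w \<open>\<alpha> > 0\<close> by simp
  finally show False using \<open>\<alpha> * \<mu> < 1\<close> by simp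
qed

section \<open>Convergence of the iteration\<close>

text \<open>A Newton direction cancels \<open>H x\<close>, so that after the step only the linearization error remains: with
  \<open>q = \<alpha> * \<mu>\<close>, both the residuals and the step lengths contract by the factor \<open>q\<close>.\<close>

lemma newton_convergence:
  fixes H :: "'a::euclidean_space \<Rightarrow> 'a"
  assumes H: "continuous_on UNIV H" and "r > 0" "\<mu> > 0" and "0 < \<alpha>" "\<alpha> * \<mu> < 1"
    and solv: "\<And>x. x \<in> ball x0 r \<Longrightarrow> \<exists>d. - H x \<in> graphical_derivative H x d"
    and bound: "\<And>x d. x \<in> ball x0 r \<Longrightarrow> - H x \<in> graphical_derivative H x d \<Longrightarrow> norm d \<le> \<mu> * norm (H x)"
    and est: "\<And>x y v. x \<in> ball x0 r \<Longrightarrow> y \<in> ball x0 r \<Longrightarrow>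
      v \<in> graphical_derivative H x (y - x) \<Longrightarrow> norm (H y - H x - v) \<le> \<alpha> * norm (y - x)"
    and start: "\<mu> * norm (H x0) \<le> r * (1 - \<alpha> * \<mu>)"
  shows "newton_well_defined H x0"
    and "newton_sequence H x0 x \<Longrightarrow> x k \<in> ball x0 r"
    and "newton_sequence H x0 x \<Longrightarrow> \<exists>xbar\<in>cball x0 r. H xbar = 0 \<and> x \<longlonglongrightarrow> xbar \<and>
          (\<forall>k\<ge>1. norm (x k - xbar) \<le> \<alpha> * \<mu> / (1 - \<alpha> * \<mu>) * norm (x k - x (k - 1)))"
proof -
  define q where "q = \<alpha> * \<mu>"
  have q: "0 < q" "q < 1" using assms by (auto simp: q_def)
  \<comment> \<open>The invariant after \<open>k\<close> steps. The strict inequality \<open>r * (1 - q ^ k) < r\<close> keeps the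
    iterates in the open ball, which is where the hypotheses on Newton directions are available.\<close>
  define I where "I = (\<lambda>k x. norm (x - x0) \<le> r * (1 - q ^ k) \<and> \<mu> * norm (H x) \<le> q ^ k * (r * (1 - q)))"
  have I_ball: "x \<in> ball x0 r" if "I k x" for k x
  proof -
    have "r * (1 - q ^ k) < r * 1" using \<open>r > 0\<close> q by (intro mult_strict_left_mono) auto
    then show ?thesis using that by (simp add: I_def dist_norm norm_minus_commute)
  qed
  have I_0: "I 0 x0" using start by (simp add: I_def q_def)
  have step: "I (Suc k) (x + d)" "\<mu> * norm (H (x + d)) \<le> q * norm d"
    if I: "I k x" and d: "- H x \<in> graphical_derivative H x d" for k x d
  proof -
    have dn: "norm d \<le> \<mu> * norm (H x)" using bound[OF I_ball[OF I] d] .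
    have "norm d \<le> q ^ k * (r * (1 - q))" using dn I by (simp add: I_def)
    then have 1: "norm (x + d - x0) \<le> r * (1 - q ^ Suc k)"
      using norm_triangle_ineq[of "x - x0" d] I by (simp add: I_def algebra_simps)
    have "r * (1 - q ^ Suc k) < r * 1" using \<open>r > 0\<close> q by (intro mult_strict_left_mono) auto
    then have "x + d \<in> ball x0 r" using 1 by (simp add: dist_norm norm_minus_commute)
    then have "norm (H (x + d) - H x - (- H x)) \<le> \<alpha> * norm (x + d - x)"
      using d I_ball[OF I] by (intro est) auto
    then have "norm (H (x + d)) \<le> \<alpha> * norm d" by simp
    then show 2: "\<mu> * norm (H (x + d)) \<le> q * norm d"
      using \<open>\<mu> > 0\<close> by (simp add: q_def mult_left_mono mult_ac)
    also have "\<dots> \<le> q * (q ^ k * (r * (1 - q)))"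
      using dn I q by (intro mult_left_mono) (auto simp: I_def)
    finally show "I (Suc k) (x + d)" using 1 by (simp add: I_def)
  qed
  have "\<exists>k. I k x" if "newton_iterate H x0 x" for x
    using that by induction (use I_0 step(1) in blast)+
  then show "newton_well_defined H x0"
    unfolding newton_well_defined_def using I_ball solv by blast
  {
    assume "newton_sequence H x0 x"
    then obtain d where x0: "x 0 = x0" and d: "\<And>k. - H (x k) \<in> graphical_derivative H (x k) (d k)"
      and xS: "\<And>k. x (Suc k) = x k + d k" unfolding newton_sequence_def by blast
    have I: "I k (x k)" for k
      by (induction k) (use I_0 x0 step(1) d xS in \<open>auto simp del: power_Suc\<close>)
    show "x k \<in> ball x0 r" using I I_ball by blast
    have contr: "norm (x (Suc (Suc k)) - x (Suc k)) \<le> q * norm (x (Suc k) - x k)" for k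
    proof -
      have "norm (d (Suc k)) \<le> \<mu> * norm (H (x (Suc k)))" using bound[OF I_ball[OF I] d] .
      also have "\<dots> \<le> q * norm (d k)" using step(2)[OF I d, of k] by (simp add: xS)
      finally show ?thesis by (simp add: xS)
    qed
    have tail: "norm (x (Suc k + j) - x (Suc k)) \<le> q / (1 - q) * norm (x (Suc k) - x k)" for k j
    proof -
      let ?s = "norm (x (Suc k) - x k)"
      have inc: "norm (x (Suc (Suc k + j)) - x (Suc k + j)) \<le> q ^ Suc j * ?s" for j
      proof (induction j)
        case (Suc j)
        have "norm (x (Suc (Suc k + Suc j)) - x (Suc k + Suc j)) \<le> q * (q ^ Suc j * ?s)"
          using contr[of "Suc k + j"] Suc q by (smt (verit, best) add_Suc_right mult_left_mono)
        then show ?case by (simp add: mult_ac)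
      qed (use contr in simp)
      \<comment> \<open>The geometric sum from 1 to \<open>j\<close>, multiplied by \<open>1 - q\<close>.\<close>
      have "(1 - q) * norm (x (Suc k + j) - x (Suc k)) \<le> (q - q ^ Suc j) * ?s"
      proof (induction j)
        case (Suc j)
        have "norm (x (Suc k + Suc j) - x (Suc k)) \<le>
           norm (x (Suc (Suc k + j)) - x (Suc k + j)) + norm (x (Suc k + j) - x (Suc k))"
          using norm_triangle_ineq[of "x (Suc (Suc k + j)) - x (Suc k + j)" "x (Suc k + j) - x (Suc k)"]
          by simp
        also have "\<dots> \<le> q ^ Suc j * ?s + norm (x (Suc k + j) - x (Suc k))" using inc[of j] by simp
        finally have "(1 - q) * norm (x (Suc k + Suc j) - x (Suc k)) \<le>
          (1 - q) * (q ^ Suc j * ?s + norm (x (Suc k + j) - x (Suc k)))"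
          using q by (intro mult_left_mono) auto
        with Suc show ?case by (simp add: algebra_simps)
      qed simp
      also have "\<dots> \<le> q * ?s" using q by (intro mult_right_mono) auto
      finally show ?thesis using q by (simp add: field_simps)
    qed
    have geo: "norm (x (Suc k) - x k) \<le> q ^ k * norm (x 1 - x 0)" for k
    proof (induction k)
      case (Suc k)
      then have "q * norm (x (Suc k) - x k) \<le> q * (q ^ k * norm (x 1 - x 0))"
        using q by (intro mult_left_mono) auto
      then show ?case using contr[of k] by simp
    qed simp
    have "summable (\<lambda>k. q ^ k * norm (x 1 - x 0))"
      using q by (intro summable_mult2 summable_geometric) auto
    then have "summable (\<lambda>k. x (Suc k) - x k)"
      by (rule summable_comparison_test'[where N = 0]) (use geo in auto)
    then have "convergent (\<lambda>n. x n - x 0)"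
      unfolding summable_iff_convergent by (simp add: sum_lessThan_telescope)
    then obtain l where "(\<lambda>n. x n - x 0) \<longlonglongrightarrow> l" unfolding convergent_def by blast
    from tendsto_add[OF this tendsto_const[of "x 0"]]
    obtain xbar where lim: "x \<longlonglongrightarrow> xbar" by auto
    have "x k \<in> cball x0 r" for k using I I_ball ball_subset_cball by blast
    then have "xbar \<in> cball x0 r" using closed_sequentially[OF closed_cball _ lim] by blast
    moreover have "H xbar = 0"
    proof -
      have Hx: "(\<lambda>k. norm (H (x k))) \<longlonglongrightarrow> norm (H xbar)"
        using H by (intro tendsto_norm isCont_tendsto_compose[OF _ lim])
          (simp add: continuous_on_eq_continuous_at)
      have "(\<lambda>k. q ^ k * (r * (1 - q)) / \<mu>) \<longlonglongrightarrow> 0 * (r * (1 - q)) / \<mu>"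
        using q \<open>\<mu> > 0\<close> by (intro tendsto_intros LIMSEQ_realpow_zero) auto
      moreover have "norm (H (x k)) \<le> q ^ k * (r * (1 - q)) / \<mu>" for k
        using I[of k] \<open>\<mu> > 0\<close> by (simp add: I_def field_simps)
      ultimately have "norm (H xbar) \<le> 0"
        by (intro LIMSEQ_le[OF Hx]) auto
      then show ?thesis by simp
    qed
    moreover have "norm (x k - xbar) \<le> q / (1 - q) * norm (x k - x (k - 1))" if "k \<ge> 1" for k
    proof -
      obtain k' where k: "k = Suc k'" using \<open>k \<ge> 1\<close> by (cases k) auto
      have "(\<lambda>j. x (j + k)) \<longlonglongrightarrow> xbar" using LIMSEQ_ignore_initial_segment[OF lim] .
      then have "(\<lambda>j. norm (x (j + k) - x k)) \<longlonglongrightarrow> norm (xbar - x k)"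
        by (intro tendsto_intros)
      then have "norm (xbar - x k) \<le> q / (1 - q) * norm (x k - x (k - 1))"
        using tail[of k'] by (intro Lim_bounded[where M = 0]) (auto simp: k add.commute)
      then show ?thesis by (simp add: norm_minus_commute)
    qed
    ultimately show "\<exists>xbar\<in>cball x0 r. H xbar = 0 \<and> x \<longlonglongrightarrow> xbar \<and>
          (\<forall>k\<ge>1. norm (x k - xbar) \<le> \<alpha> * \<mu> / (1 - \<alpha> * \<mu>) * norm (x k - x (k - 1)))"
      using lim unfolding q_def by blast
  }
qed

section \<open>The convergence theorem\<close>

theorem theorem3p4:
  fixes H :: "real ^ 'n \<Rightarrow> real ^ 'n"
    and x0 :: "real ^ 'n"
    and r \<mu> \<alpha> :: real
    and \<Omega> :: "(real ^ 'n) set"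
  assumes cont: "continuous_on UNIV H"
    and r: "r > 0"
    and Omega: "\<Omega> = {x. norm (x - x0) \<le> r}"
    and mu: "\<mu> > 0"
    and a: "\<forall>x\<in>\<Omega>. metrically_regular_around H \<mu> x"
    and b: "\<forall>\<epsilon>>0. \<exists>\<delta>>0. \<forall>x\<in>\<Omega>. \<forall>z w.
              w \<in> graphical_derivative H x z \<and> norm z \<le> \<delta> \<longrightarrow> norm w \<le> \<epsilon>"
    and alpha: "0 < \<alpha>" "\<alpha> < 1 / \<mu>"
    and c_start: "\<mu> * norm (H x0) \<le> r * (1 - \<alpha> * \<mu>)"
    and c_estimate:
      "(\<forall>x\<in>\<Omega>. \<forall>y\<in>\<Omega>. \<forall>v \<in> graphical_derivative H x (y - x).
          norm (H x - H y - v) \<le> \<alpha> * norm (x - y)) \<or>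
       (\<forall>x\<in>\<Omega>. \<forall>y\<in>\<Omega>. \<forall>v \<in> graphical_derivative H x (y - x).
          norm (H y - H x - v) \<le> \<alpha> * norm (x - y))"
  shows "newton_well_defined H x0 \<and>
    (\<forall>x. newton_sequence H x0 x \<longrightarrow>
       (\<forall>k. x k \<in> \<Omega>) \<and>
       (\<exists>xbar\<in>\<Omega>. H xbar = 0 \<and> x \<longlonglongrightarrow> xbar \<and>
          (\<forall>k\<ge>1. norm (x k - xbar) \<le> \<alpha> * \<mu> / (1 - \<alpha> * \<mu>) * norm (x k - x (k - 1)))))"
proof -
  have \<Omega>: "\<Omega> = cball x0 r" unfolding Omega by (auto simp: dist_norm norm_minus_commute)
  have \<Omega>_ball: "x \<in> \<Omega>" if "x \<in> ball x0 r" for x using that by (auto simp: \<Omega>)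
  have q: "\<alpha> * \<mu> < 1" using alpha mu by (simp add: field_simps)
  obtain \<delta> where \<delta>: "\<delta> > 0" "\<And>x z w. x \<in> \<Omega> \<Longrightarrow> w \<in> graphical_derivative H x z \<Longrightarrow> norm z \<le> \<delta> \<Longrightarrow> norm w \<le> 1"
    using b[rule_format, of 1] by auto
  define L where "L = 1 / \<delta> + 1"
  have GD: "norm w \<le> 1 / \<delta> * norm z" if "x \<in> \<Omega>" "w \<in> graphical_derivative H x z" for x z w
    using norm_graphical_derivative_le[OF \<delta>(2)[OF that(1)] \<delta>(1) that(2)] by simp
  have lip: "L-lipschitz_on \<Omega> H"
  proof (rule lipschitz_on_if_calm)
    show "convex \<Omega>" by (simp add: \<Omega>)
    show "continuous_on \<Omega> H" using cont continuous_on_subset by blast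
    show "0 \<le> L" using \<delta> by (simp add: L_def)
    show "\<forall>\<^sub>F y in nhds x. norm (H y - H x) \<le> L * norm (y - x)" if "x \<in> \<Omega>" for x
      using cont \<delta> GD[OF that]
      by (intro calm_if_graphical_derivative_bounded[where L = "1 / \<delta>"])
         (auto simp: continuous_on_eq_continuous_at L_def)
  qed
  have lip': "L-lipschitz_on (ball x0 r) H" using lip by (rule lipschitz_on_subset) (auto simp: \<Omega>)
  have est: "norm (H y - H x - v) \<le> \<alpha> * norm (y - x)"
    if "x \<in> \<Omega>" "y \<in> \<Omega>" "v \<in> graphical_derivative H x (y - x)" for x y v
    using c_estimate
  proof
    assume reversed: "\<forall>x\<in>\<Omega>. \<forall>y\<in>\<Omega>. \<forall>v \<in> graphical_derivative H x (y - x).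
          norm (H x - H y - v) \<le> \<alpha> * norm (x - y)"
    have False
      by (rule reversed_estimate_impossible[OF cont _ open_ball _ lip' mu q alpha(1), where x = x0])
         (use a r reversed \<Omega>_ball in auto)
    then show ?thesis ..
  qed (use that in \<open>auto simp: norm_minus_commute\<close>)
  have bound: "norm d \<le> \<mu> * norm w" if x: "x \<in> ball x0 r" and d: "w \<in> graphical_derivative H x d" for x w d
  proof -
    \<comment> \<open>Iterates stay in the open ball, so that some smaller ball around \<open>x\<close> lies in \<open>\<Omega>\<close>.\<close>
    define R where "R = (r - dist x0 x) / 4"
    have R: "R > 0" using x by (simp add: R_def)
    have sub: "ball x (4 * R) \<subseteq> \<Omega>"
    proof
      fix y assume "y \<in> ball x (4 * R)"
      then show "y \<in> \<Omega>" using dist_triangle[of x0 y x] by (simp add: R_def \<Omega>)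
    qed
    have reg: "metrically_regular_around H \<mu> x" using a \<Omega>_ball[OF x] by blast
    obtain \<rho> c where \<rho>: "\<rho> > 0" "c > 0"
      "\<And>u v. u \<in> ball x \<rho> \<Longrightarrow> v \<in> ball x \<rho> \<Longrightarrow> c * norm (v - u) \<le> norm (H v - H u)"
      using locally_expanding[OF cont R lipschitz_on_subset[OF lip sub] est mu alpha(1) q reg] sub
      by blast
    have "inj_on H (ball x \<rho>)"
    proof (rule inj_onI)
      fix u v assume "u \<in> ball x \<rho>" "v \<in> ball x \<rho>" "H u = H v"
      then show "u = v" using \<rho>(3)[of u v] \<rho>(2) by (simp add: mult_le_0_iff)
    qed
    then show ?thesis using graphical_derivative_inverse_bound[OF cont reg \<rho>(1) _ d] by blast
  qed
  have solv: "\<exists>d. - H x \<in> graphical_derivative H x d" if "x \<in> ball x0 r" for x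
    using graphical_derivative_surjective[of H \<mu> x "- H x"] cont a \<Omega>_ball[OF that] by metis
  have bound': "norm d \<le> \<mu> * norm (H x)"
    if "x \<in> ball x0 r" "- H x \<in> graphical_derivative H x d" for x d
    using bound[OF that] by simp
  note conv = newton_convergence[OF cont r mu alpha(1) q solv bound' est[OF \<Omega>_ball \<Omega>_ball] c_start]
  show ?thesis using conv \<Omega> \<Omega>_ball by blast
qed

end
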